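(* Let $\alpha\in[0,1)$ and let $G$ be a connected graph of order $n$ with $n\geq f(\alpha)$. If $\rho_{\alpha}(G)>\eta(n)$, then $G$ is a $P_{\geq2}$-factor covered graph.
   Context: All graphs are finite, simple and undirected. For a graph $G$, $D(G)$ is the diagonal matrix of vertex degrees and $A(G)$ the adjacency matrix; for $\alpha\in[0,1)$, $A_{\alpha}(G)=\alpha D(G)+(1-\alpha)A(G)$, and $\rho_{\alpha}(G)$ denotes the largest eigenvalue of $A_{\alpha}(G)$. A path factor of $G$ is a spanning subgraph each of whose components is a path with at least two vertices; a $P_{\geq k}$-factor is a path factor in which every component has at least $k$ vertices. $G$ is a $P_{\geq k}$-factor covered graph if for every edge $e\in E(G)$ there is a $P_{\geq k}$-factor of $G$ containing $e$. Define $f(\alpha)=14$ if $\alpha\in[0,\frac12]$, $f(\alpha)=17$ if $\alpha\in(\frac12,\frac23]$, $f(\alpha)=20$ if $\alpha\in(\frac23,\frac34]$, and $f(\alpha)=\frac{5}{1-\alpha}+1$ if $\alpha\in(\frac34,1)$. Let $\eta(n)$ be the largest root of $x^{3}-((\alpha+1)n+\alpha-4)x^{2}+(\alpha n^{2}+(\alpha^{2}-2\alpha-1)n-2\alpha+1)x-\alpha^{2}n^{2}+(5\alpha^{2}-3\alpha+2)n-10\alpha^{2}+15\alpha-8=0$. *)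

theory Defs
  imports Complex_Main
begin

text \<open>A finite simple graph: a finite vertex set V and a set E of 2-element subsets of V.\<close>
definition simple_graph :: "'a set \<Rightarrow> 'a set set \<Rightarrow> bool" where
  "simple_graph V E \<longleftrightarrow> finite V \<and> (\<forall>e\<in>E. \<exists>u v. e = {u, v} \<and> u \<noteq> v \<and> u \<in> V \<and> v \<in> V)"

definition adj :: "'a set set \<Rightarrow> 'a \<Rightarrow> 'a \<Rightarrow> bool" where
  "adj E u v \<longleftrightarrow> {u, v} \<in> E"

definition connected_graph :: "'a set \<Rightarrow> 'a set set \<Rightarrow> bool" where
  "connected_graph V E \<longleftrightarrow> (\<forall>u\<in>V. \<forall>v\<in>V. (u, v) \<in> {(x, y). adj E x y}\<^sup>*)"

definition degree :: "'a set \<Rightarrow> 'a set set \<Rightarrow> 'a \<Rightarrow> nat" where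
  "degree V E v = card {u\<in>V. adj E u v}"

text \<open>Entries of A_alpha(G) = alpha D(G) + (1 - alpha) A(G), indexed by V x V.\<close>
definition A_alpha :: "real \<Rightarrow> 'a set \<Rightarrow> 'a set set \<Rightarrow> 'a \<Rightarrow> 'a \<Rightarrow> real" where
  "A_alpha \<alpha> V E u v =
     \<alpha> * (if u = v then real (degree V E u) else 0) + (1 - \<alpha>) * (if adj E u v then 1 else 0)"

text \<open>(Real) eigenvalue of a V x V matrix M.\<close>
definition is_eigenvalue :: "'a set \<Rightarrow> ('a \<Rightarrow> 'a \<Rightarrow> real) \<Rightarrow> real \<Rightarrow> bool" where
  "is_eigenvalue V M mu \<longleftrightarrow>
     (\<exists>x :: 'a \<Rightarrow> real. (\<exists>v\<in>V. x v \<noteq> 0) \<and> (\<forall>u\<in>V. (\<Sum>v\<in>V. M u v * x v) = mu * x u))"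

definition rho_alpha :: "real \<Rightarrow> 'a set \<Rightarrow> 'a set set \<Rightarrow> real" where
  "rho_alpha \<alpha> V E = Max {mu. is_eigenvalue V (A_alpha \<alpha> V E) mu}"

text \<open>Edges of a path given as a vertex list.\<close>
definition path_edges :: "'a list \<Rightarrow> 'a set set" where
  "path_edges p = {{p ! i, p ! Suc i} | i. Suc i < length p}"

definition is_path_in :: "'a set set \<Rightarrow> 'a list \<Rightarrow> bool" where
  "is_path_in E p \<longleftrightarrow> distinct p \<and> path_edges p \<subseteq> E"

text \<open>F is (the edge set of) a P_{>=k}-factor of G: a spanning subgraph whose components are
  paths, each with at least max 2 k vertices; the components are given by vertex lists.\<close>
definition is_P_ge_factor :: "nat \<Rightarrow> 'a set \<Rightarrow> 'a set set \<Rightarrow> 'a set set \<Rightarrow> bool" where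
  "is_P_ge_factor k V E F \<longleftrightarrow>
     (\<exists>P :: 'a list set.
        (\<forall>p\<in>P. is_path_in E p \<and> length p \<ge> 2 \<and> length p \<ge> k) \<and>
        (\<forall>p\<in>P. \<forall>q\<in>P. p \<noteq> q \<longrightarrow> set p \<inter> set q = {}) \<and>
        (\<Union>p\<in>P. set p) = V \<and>
        F = (\<Union>p\<in>P. path_edges p))"

definition P_ge_factor_covered :: "nat \<Rightarrow> 'a set \<Rightarrow> 'a set set \<Rightarrow> bool" where
  "P_ge_factor_covered k V E \<longleftrightarrow> (\<forall>e\<in>E. \<exists>F. is_P_ge_factor k V E F \<and> e \<in> F)"

definition f_bound :: "real \<Rightarrow> real" where
  "f_bound \<alpha> = (if \<alpha> \<le> 1/2 then 14 else if \<alpha> \<le> 2/3 then 17 else if \<alpha> \<le> 3/4 then 20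
                 else 5 / (1 - \<alpha>) + 1)"

definition eta_poly :: "real \<Rightarrow> real \<Rightarrow> real \<Rightarrow> real" where
  "eta_poly \<alpha> n x = x ^ 3 - ((\<alpha> + 1) * n + \<alpha> - 4) * x ^ 2
     + (\<alpha> * n ^ 2 + (\<alpha> ^ 2 - 2 * \<alpha> - 1) * n - 2 * \<alpha> + 1) * x
     - \<alpha> ^ 2 * n ^ 2 + (5 * \<alpha> ^ 2 - 3 * \<alpha> + 2) * n - 10 * \<alpha> ^ 2 + 15 * \<alpha> - 8"

definition eta :: "real \<Rightarrow> real \<Rightarrow> real" where
  "eta \<alpha> n = Max {x. eta_poly \<alpha> n x = 0}"

end

theory Submission
  imports "Jordan_Normal_Form.Spectral_Radius" Defs
begin

text \<open>
  An edge \<open>xy\<close> lies in a path factor iff some edge set containing \<open>xy\<close> covers \<open>V\<close> with all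
  degrees at most 2. To find one, send every other vertex to a neighbour, with capacity 1 at
  \<open>x\<close>, \<open>y\<close> and 2 elsewhere (Hall), and then drop superfluous arcs. If Hall's condition fails, there
  are a nonempty \<open>S\<close> and a set \<open>J\<close> of at least \<open>max 2 (2|S| - 1)\<close> vertices whose neighbours all lie
  in \<open>S\<close>.

  In that case every eigenvalue is bounded by means of a positive vector that is constant on \<open>S\<close>,
  on \<open>J\<close> and on the remaining vertices. For \<open>|S| = 1\<close> the Perron vector of
  \<open>K_1 \<or> (K_{n-3} \<union> 2K_1)\<close>, whose quotient matrix has characteristic polynomial \<open>eta_poly\<close>, yields
  the bound \<open>eta\<close>; for \<open>|S| \<ge> 2\<close> a suitable vector yields the bound \<open>n - 3\<close>, which is below \<open>eta\<close>.
\<close>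

subsection \<open>Hall's theorem and degree-bounded edge covers\<close>

text \<open>Induction in the style of Halmos and Vaughan. If some nonempty proper \<open>K\<close>
  is tight, it is matched inside its own union \<open>T\<close> and the other indices are matched
  outside \<open>T\<close>. Otherwise every such set has a surplus, so one index may be given an
  arbitrary element \<open>b\<close>.\<close>

lemma hall_marriage:
  fixes A :: "'i \<Rightarrow> 'b set"
  assumes "finite I" and "\<And>i. i \<in> I \<Longrightarrow> finite (A i)"
    and "\<And>K. K \<subseteq> I \<Longrightarrow> card K \<le> card (\<Union>(A ` K))"
  shows "\<exists>f. inj_on f I \<and> (\<forall>i\<in>I. f i \<in> A i)"
  using assms
proof (induction "card I" arbitrary: I A rule: less_induct)
  case less
  note fin = less.prems(1) and finA = less.prems(2) and hall = less.prems(3)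
  show ?case
  proof (cases "I = {}")
    case True
    then show ?thesis by simp
  next
    case False
    then obtain i where i: "i \<in> I" by blast
    show ?thesis
    proof (cases "\<exists>K. K \<subset> I \<and> K \<noteq> {} \<and> card K = card (\<Union>(A ` K))")
      case True
      then obtain K where K: "K \<subset> I" "K \<noteq> {}" "card K = card (\<Union>(A ` K))" by blast
      define T where "T = \<Union>(A ` K)"
      have finK: "finite K" using K(1) fin by (meson finite_subset psubset_imp_subset)
      have finT: "finite T" unfolding T_def using finK finA K(1) by blast
      have "\<exists>f. inj_on f K \<and> (\<forall>i\<in>K. f i \<in> A i)"
      proof (rule less.hyps)
        show "card K < card I" using K(1) fin by (rule psubset_card_mono[rotated])
        show "finite K" by (fact finK)
        show "finite (A i)" if "i \<in> K" for i using that K(1) finA by blast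
        show "card L \<le> card (\<Union>(A ` L))" if "L \<subseteq> K" for L
          using that K(1) hall[of L] by blast
      qed
      then obtain f where f: "inj_on f K" "\<And>i. i \<in> K \<Longrightarrow> f i \<in> A i" by blast
      \<comment> \<open>Hall's condition survives the deletion of \<open>T\<close>: apply it to
        \<open>L \<union> K\<close> and subtract the equality for the tight set
        \<open>K\<close>.\<close>
      have "\<exists>g. inj_on g (I - K) \<and> (\<forall>i\<in>I - K. g i \<in> A i - T)"
      proof (rule less.hyps)
        show "card (I - K) < card I"
          using K(1,2) fin by (intro psubset_card_mono) auto
        show "finite (I - K)" using fin by simp
        show "finite (A i - T)" if "i \<in> I - K" for i using that finA by blast
        show "card L \<le> card (\<Union>i\<in>L. A i - T)" if L: "L \<subseteq> I - K" for L
        proof -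
          have finL: "finite L" using L fin by (meson finite_Diff finite_subset)
          have "finite (\<Union>i\<in>L. A i - T)" using finL L finA by blast
          moreover have "\<Union>(A ` (L \<union> K)) = (\<Union>i\<in>L. A i - T) \<union> T"
            unfolding T_def by blast
          moreover have "(\<Union>i\<in>L. A i - T) \<inter> T = {}" by blast
          ultimately have "card (\<Union>(A ` (L \<union> K))) = card (\<Union>i\<in>L. A i - T) + card T"
            using finT by (metis card_Un_disjoint)
          moreover have "card (L \<union> K) = card L + card K"
            using L finL finK by (intro card_Un_disjoint) auto
          moreover have "card (L \<union> K) \<le> card (\<Union>(A ` (L \<union> K)))"
            using L K(1) by (intro hall) auto
          ultimately show ?thesis using K(3) unfolding T_def by linarith
        qed
      qed
      then obtain g where g: "inj_on g (I - K)" "\<And>i. i \<in> I - K \<Longrightarrow> g i \<in> A i - T" by blast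
      define h where "h i = (if i \<in> K then f i else g i)" for i
      have "inj_on h I"
      proof (rule inj_onI)
        fix i j assume ij: "i \<in> I" "j \<in> I" "h i = h j"
        have "i \<in> K \<longleftrightarrow> j \<in> K"
          using ij f(2) g(2) unfolding h_def T_def by (auto split: if_splits; metis DiffI UN_I DiffD2)
        then show "i = j"
          using ij f(1) g(1) unfolding h_def inj_on_def by (auto split: if_splits)
      qed
      moreover have "\<forall>i\<in>I. h i \<in> A i" using f(2) g(2) unfolding h_def by auto
      ultimately show ?thesis by blast
    next
      case strict: False
      have "card {i} \<le> card (\<Union>(A ` {i}))" using i by (intro hall) auto
      then obtain b where b: "b \<in> A i" by fastforce
      \<comment> \<open>Deleting \<open>b\<close> costs each union at most one element, which the
        strict form of Hall's inequality pays for.\<close>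
      have "\<exists>g. inj_on g (I - {i}) \<and> (\<forall>j\<in>I - {i}. g j \<in> A j - {b})"
      proof (rule less.hyps)
        show "card (I - {i}) < card I" using i fin by (rule card_Diff1_less[rotated])
        show "finite (I - {i})" using fin by simp
        show "finite (A j - {b})" if "j \<in> I - {i}" for j using that finA by blast
        show "card L \<le> card (\<Union>j\<in>L. A j - {b})" if L: "L \<subseteq> I - {i}" for L
        proof (cases "L = {}")
          case False
          have "card L \<le> card (\<Union>(A ` L))" "card L \<noteq> card (\<Union>(A ` L))"
            using L i False strict hall[of L] by blast+
          moreover have "(\<Union>j\<in>L. A j - {b}) = \<Union>(A ` L) - {b}" by blast
          moreover have "card (\<Union>(A ` L)) - 1 \<le> card (\<Union>(A ` L) - {b})"
            by (metis card_Diff_singleton_if diff_le_self le_refl)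
          ultimately show ?thesis by simp
        qed simp
      qed
      then obtain g where g: "inj_on g (I - {i})" "\<And>j. j \<in> I - {i} \<Longrightarrow> g j \<in> A j - {b}" by blast
      have "inj_on (g(i := b)) I"
        using g unfolding inj_on_def by (auto split: if_splits)
      moreover have "\<forall>j\<in>I. (g(i := b)) j \<in> A j" using b g(2) by auto
      ultimately show ?thesis by blast
    qed
  qed
qed

text \<open>Replace every target \<open>w\<close> by \<open>c w\<close> copies \<open>(w, k)\<close>
  and apply the marriage theorem to the copies; forgetting the copy index gives
  \<open>\<phi>\<close>, with each target hit at most as often as it has copies.\<close>

lemma hall_with_capacities:
  fixes N :: "'i \<Rightarrow> 'b set" and c :: "'b \<Rightarrow> nat"
  assumes fin: "finite U" and finN: "\<And>u. u \<in> U \<Longrightarrow> finite (N u)"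
    and hall: "\<And>X. X \<subseteq> U \<Longrightarrow> card X \<le> sum c (\<Union>(N ` X))"
  obtains \<phi> where "\<And>u. u \<in> U \<Longrightarrow> \<phi> u \<in> N u" and "\<And>w. card {u \<in> U. \<phi> u = w} \<le> c w"
proof -
  define A where "A u = Sigma (N u) (\<lambda>w. {..<c w})" for u
  have "\<exists>f. inj_on f U \<and> (\<forall>u\<in>U. f u \<in> A u)"
  proof (rule hall_marriage)
    show "finite U" by (fact fin)
    show "finite (A u)" if "u \<in> U" for u unfolding A_def using finN[OF that] by simp
    show "card X \<le> card (\<Union>(A ` X))" if X: "X \<subseteq> U" for X
    proof -
      have "\<Union>(A ` X) = Sigma (\<Union>(N ` X)) (\<lambda>w. {..<c w})" unfolding A_def by blast
      moreover have "finite (\<Union>(N ` X))" using finite_subset[OF X fin] X finN by auto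
      ultimately have "card (\<Union>(A ` X)) = sum c (\<Union>(N ` X))" by simp
      then show ?thesis using hall[OF X] by simp
    qed
  qed
  then obtain f where f: "inj_on f U" "\<And>u. u \<in> U \<Longrightarrow> f u \<in> A u" by blast
  show thesis
  proof
    show "(fst \<circ> f) u \<in> N u" if "u \<in> U" for u
      using f(2)[OF that] unfolding A_def by auto
    show "card {u \<in> U. (fst \<circ> f) u = w} \<le> c w" for w
    proof -
      have "f ` {u \<in> U. (fst \<circ> f) u = w} \<subseteq> {w} \<times> {..<c w}"
        using f(2) unfolding A_def by force
      moreover have "inj_on f {u \<in> U. (fst \<circ> f) u = w}"
        using f(1) by (rule inj_on_subset) auto
      ultimately have "card {u \<in> U. (fst \<circ> f) u = w} \<le> card ({w} \<times> {..<c w})"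
        by (intro card_inj_on_le) auto
      then show ?thesis by (simp add: card_cartesian_product)
    qed
  qed
qed

text \<open>
  Keeping the arc of a vertex \<open>v\<close> outside the image of \<open>\<phi>\<close> covers its target as well, so both can be
  discarded, the target retaining capacity 1; if there is no such \<open>v\<close>, then \<open>\<phi>\<close> permutes \<open>U\<close>.
\<close>

lemma arc_selection:
  fixes \<phi> :: "'a \<Rightarrow> 'a"
  assumes "finite U" and "\<And>w. card {u \<in> U. \<phi> u = w} \<le> (if w \<in> U then 2 else 1)"
  shows "\<exists>D\<subseteq>U. (\<forall>u\<in>U. u \<in> D \<or> u \<in> \<phi> ` D) \<and>
    (\<forall>w. card {v \<in> D. \<phi> v = w} + (if w \<in> D then 1 else 0) \<le> (if w \<in> U then 2 else 1))"
  using assms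
proof (induction "card U" arbitrary: U rule: less_induct)
  case less
  note fin = less.prems(1) and cap = less.prems(2)
  show ?case
  proof (cases "U \<subseteq> \<phi> ` U")
    case True
    have "card (\<phi> ` U) \<le> card U" using fin by (rule card_image_le)
    then have eq: "\<phi> ` U = U" using True fin by (metis card_seteq finite_imageI)
    then have inj: "inj_on \<phi> U" using fin by (simp add: eq_card_imp_inj_on)
    have "card {v \<in> U. \<phi> v = w} \<le> 1" for w
    proof (rule card_le_Suc0_iff_eq[THEN iffD2, simplified One_nat_def[symmetric]])
      show "finite {v \<in> U. \<phi> v = w}" using fin by simp
      show "\<forall>a\<in>{v \<in> U. \<phi> v = w}. \<forall>b\<in>{v \<in> U. \<phi> v = w}. a = b"
        using inj unfolding inj_on_def by auto
    qed
    moreover have "card {v \<in> U. \<phi> v = w} = 0" if "w \<notin> U" for w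
      using that eq fin by (subst card_0_eq) auto
    ultimately have "card {v \<in> U. \<phi> v = w} + (if w \<in> U then 1 else 0) \<le> (if w \<in> U then 2 else 1)" for w
      by (cases "w \<in> U") (simp_all add: numeral_2_eq_2)
    then show ?thesis using eq by blast
  next
    case False
    then obtain v where v: "v \<in> U" "v \<notin> \<phi> ` U" by blast
    define p where "p = \<phi> v"
    define U' where "U' = U - {v, p}"
    have pv: "p \<noteq> v" using v unfolding p_def by (metis image_eqI)
    have sub: "card {u \<in> U'. \<phi> u = w} \<le> card {u \<in> U. \<phi> u = w}" for w
      using fin unfolding U'_def by (intro card_mono) auto
    have subp: "card {u \<in> U'. \<phi> u = p} + 1 \<le> card {u \<in> U. \<phi> u = p}"
    proof -
      have "card (insert v {u \<in> U'. \<phi> u = p}) \<le> card {u \<in> U. \<phi> u = p}"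
        using fin v unfolding U'_def p_def by (intro card_mono) auto
      then show ?thesis using fin unfolding U'_def by simp
    qed
    have "\<exists>D\<subseteq>U'. (\<forall>u\<in>U'. u \<in> D \<or> u \<in> \<phi> ` D) \<and>
      (\<forall>w. card {v \<in> D. \<phi> v = w} + (if w \<in> D then 1 else 0) \<le> (if w \<in> U' then 2 else 1))"
    proof (rule less.hyps)
      show "card U' < card U" using v fin unfolding U'_def by (intro psubset_card_mono) auto
      show "finite U'" using fin unfolding U'_def by simp
      \<comment> \<open>If \<open>p\<close> lies in \<open>U\<close>, leaving it lowers its capacity
        from 2 to 1, but \<open>p\<close> has also lost the preimage \<open>v\<close>. Nothing maps
        to \<open>v\<close>, and all other capacities are unchanged.\<close>
      show "card {u \<in> U'. \<phi> u = w} \<le> (if w \<in> U' then 2 else 1)" for w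
      proof -
        consider "w = p" | "w = v" | "w \<noteq> p" "w \<noteq> v" by blast
        then show ?thesis
        proof cases
          case 1
          then show ?thesis using subp cap[of p] unfolding U'_def by (auto split: if_splits)
        next
          case 2
          then have "{u \<in> U'. \<phi> u = w} = {}" using v unfolding U'_def by blast
          then show ?thesis by (simp only: card.empty)
        next
          case 3
          then have "w \<in> U' \<longleftrightarrow> w \<in> U" unfolding U'_def by blast
          then show ?thesis using sub[of w] cap[of w] by auto
        qed
      qed
    qed
    then obtain D where D: "D \<subseteq> U'" "\<And>u. u \<in> U' \<Longrightarrow> u \<in> D \<or> u \<in> \<phi> ` D"
      "\<And>w. card {v \<in> D. \<phi> v = w} + (if w \<in> D then 1 else 0) \<le> (if w \<in> U' then 2 else 1)"
      by blast
    have finD: "finite D" using D(1) fin unfolding U'_def by (meson finite_Diff finite_subset)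
    have vpD: "v \<notin> D" "p \<notin> D" using D(1) unfolding U'_def by auto
    \<comment> \<open>At \<open>p\<close> the bound comes from the original capacity:
      \<open>p\<close> sends no arc itself, and its selected preimages, \<open>v\<close> included,
      are among those in \<open>U\<close>.\<close>
    have "card {u \<in> insert v D. \<phi> u = w} + (if w \<in> insert v D then 1 else 0) \<le> (if w \<in> U then 2 else 1)"
      for w
    proof -
      consider "w = p" | "w = v" | "w \<noteq> p" "w \<noteq> v" by blast
      then show ?thesis
      proof cases
        case 1
        have "{u \<in> insert v D. \<phi> u = p} = insert v {u \<in> D. \<phi> u = p}" unfolding p_def by auto
        then have "card {u \<in> insert v D. \<phi> u = p} = card {u \<in> D. \<phi> u = p} + 1"
          using finD vpD by simp
        moreover have "card {u \<in> D. \<phi> u = p} \<le> card {u \<in> U'. \<phi> u = p}"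
          using fin D(1) unfolding U'_def by (intro card_mono) auto
        ultimately show ?thesis using 1 subp cap[of p] vpD pv by (auto split: if_splits)
      next
        case 2
        then have "{u \<in> insert v D. \<phi> u = w} = {}" using v D(1) unfolding U'_def by auto
        then show ?thesis using 2 v by (simp only: card.empty) simp
      next
        case 3
        then have "w \<in> U' \<longleftrightarrow> w \<in> U" "{u \<in> insert v D. \<phi> u = w} = {u \<in> D. \<phi> u = w}"
          unfolding U'_def p_def by auto
        then show ?thesis using D(3)[of w] 3 by auto
      qed
    qed
    moreover have "u \<in> insert v D \<or> u \<in> \<phi> ` insert v D" if "u \<in> U" for u
      using that D(2)[of u] unfolding U'_def p_def by blast
    moreover have "insert v D \<subseteq> U" using v D(1) unfolding U'_def by blast
    ultimately show ?thesis by blast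
  qed
qed

subsection \<open>Path factors through a given edge\<close>

lemma path_edges_simps [simp]:
  "path_edges [a] = {}"
  "path_edges (a # b # p) = insert {a, b} (path_edges (b # p))"
proof -
  show "path_edges [a] = {}" unfolding path_edges_def by simp
  show "path_edges (a # b # p) = insert {a, b} (path_edges (b # p))" (is "?L = ?R")
  proof (intro equalityI subsetI)
    fix f assume "f \<in> ?L"
    then obtain i where i: "f = {(a # b # p) ! i, (a # b # p) ! Suc i}" "Suc i < length (a # b # p)"
      unfolding path_edges_def by blast
    show "f \<in> ?R"
    proof (cases i)
      case 0
      then show ?thesis using i by simp
    next
      case (Suc k)
      then have "f = {(b # p) ! k, (b # p) ! Suc k}" "Suc k < length (b # p)" using i by auto
      then show ?thesis unfolding path_edges_def by blast
    qed
  next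
    fix f assume "f \<in> ?R"
    then consider "f = {a, b}" | k where "f = {(b # p) ! k, (b # p) ! Suc k}" "Suc k < length (b # p)"
      unfolding path_edges_def by blast
    then show "f \<in> ?L"
    proof cases
      case 1
      then show ?thesis unfolding path_edges_def by (intro CollectI exI[of _ 0]) simp
    next
      case (2 k)
      then show ?thesis unfolding path_edges_def by (intro CollectI exI[of _ "Suc k"]) simp
    qed
  qed
qed

lemma Union_path_edges: "2 \<le> length p \<Longrightarrow> \<Union>(path_edges p) = set p"
proof (induction p rule: induct_list012)
  case (3 a b p)
  then show ?case by (cases p) auto
qed simp_all

text \<open>The host graph is left out and the vertex set is read off from \<open>M\<close>, so that
  whole components can be deleted from \<open>M\<close> in an induction.\<close>

definition path_decomposition :: "'a set set \<Rightarrow> 'a list set \<Rightarrow> bool" where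
  "path_decomposition M P \<longleftrightarrow>
     (\<forall>p\<in>P. distinct p \<and> 2 \<le> length p) \<and>
     (\<forall>p\<in>P. \<forall>q\<in>P. p \<noteq> q \<longrightarrow> set p \<inter> set q = {}) \<and>
     (\<Union>p\<in>P. set p) = \<Union>M \<and> (\<Union>p\<in>P. path_edges p) = M"

lemma path_decomposition_insert:
  assumes "path_decomposition M P" and "distinct p" and "2 \<le> length p"
    and "set p \<inter> \<Union>M = {}"
  shows "path_decomposition (M \<union> path_edges p) (insert p P)"
proof -
  have "set p \<inter> set q = {}" if "q \<in> P" for q
    using that assms(1,4) unfolding path_decomposition_def by blast
  then show ?thesis
    using assms Union_path_edges[OF assms(3)] unfolding path_decomposition_def by (auto simp: Int_commute)
qed

text \<open>Since every edge has an end of degree 1, the components are stars, and the degree bound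
  leaves only paths on two or three vertices. One component is split off at a time.\<close>

lemma star_forest_decomposition:
  assumes "finite M" and "\<And>f. f \<in> M \<Longrightarrow> card f = 2"
    and "\<And>w. card {f \<in> M. w \<in> f} \<le> 2"
    and "\<And>f. f \<in> M \<Longrightarrow> \<exists>w\<in>f. {g \<in> M. w \<in> g} = {f}"
  shows "\<exists>P. path_decomposition M P"
  using assms
proof (induction "card M" arbitrary: M rule: less_induct)
  case less
  note fin = less.prems(1) and two = less.prems(2) and deg = less.prems(3) and priv = less.prems(4)
  show ?case
  proof (cases "M = {}")
    case True
    then show ?thesis by (intro exI[of _ "{}"]) (simp add: path_decomposition_def)
  next
    case False
    then obtain f where f: "f \<in> M" by blast
    obtain u where u: "u \<in> f" "{g \<in> M. u \<in> g} = {f}" using priv[OF f] by blast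
    obtain v where v: "f = {u, v}" "u \<noteq> v"
      using two[OF f] u(1) by (auto simp: card_2_iff)
    \<comment> \<open>As \<open>u\<close> is a leaf, the component of \<open>f\<close> is found at
      \<open>v\<close>: it is \<open>f\<close> alone, or \<open>f\<close> with one further edge
      whose other end is again a leaf.\<close>
    define K where "K = {g \<in> M. v \<in> g}"
    have fK: "f \<in> K" using f v unfolding K_def by simp
    have finK: "finite K" using fin unfolding K_def by simp
    have "\<exists>p. distinct p \<and> 2 \<le> length p \<and> path_edges p = K \<and>
      set p \<inter> \<Union>(M - K) = {}"
    proof (cases "K = {f}")
      case True
      have "g = f" if "g \<in> M" "u \<in> g \<or> v \<in> g" for g
        using that u(2) True unfolding K_def by blast
      then show ?thesis using True v by (intro exI[of _ "[u, v]"]) auto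
    next
      case False
      then obtain g where g: "g \<in> K" "g \<noteq> f" using fK by blast
      have K: "K = {f, g}"
        using card_seteq[of K "{f, g}"] finK fK g deg[of v] unfolding K_def by auto
      obtain w where w: "w \<in> g" "{h \<in> M. w \<in> h} = {g}" using priv[of g] g unfolding K_def by blast
      have "w \<noteq> v"
      proof
        assume "w = v"
        then have "f \<in> {h \<in> M. w \<in> h}" using f v(1) by simp
        then show False using w(2) g(2) by simp
      qed
      moreover have "v \<in> g" "g \<in> M" using g unfolding K_def by auto
      ultimately have gvw: "g = {v, w}" using two[of g] w(1) by (auto simp: card_2_iff)
      have "u \<noteq> w" using u(2) w(2) g(2) by (metis singleton_inject)
      have "h \<in> K" if "h \<in> M" "u \<in> h \<or> v \<in> h \<or> w \<in> h" for h
      proof -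
        have "h \<in> {h \<in> M. u \<in> h} \<or> h \<in> {h \<in> M. v \<in> h} \<or> h \<in> {h \<in> M. w \<in> h}" using that by simp
        then show ?thesis unfolding u(2) w(2) K_def[symmetric] using fK g(1) by blast
      qed
      then have "set [u, v, w] \<inter> \<Union>(M - K) = {}" by auto
      moreover have "path_edges [u, v, w] = K" using K v gvw by simp
      ultimately show ?thesis using v(2) \<open>w \<noteq> v\<close> \<open>u \<noteq> w\<close>
        by (intro exI[of _ "[u, v, w]"]) (simp del: path_edges_simps)
    qed
    then obtain p where p: "distinct p" "2 \<le> length p" "path_edges p = K"
      "set p \<inter> \<Union>(M - K) = {}" by blast
    have "\<exists>P. path_decomposition (M - K) P"
    proof (rule less.hyps)
      show "card (M - K) < card M" using fin f fK by (intro psubset_card_mono) auto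
      show "finite (M - K)" using fin by simp
      show "card g = 2" if "g \<in> M - K" for g using that two by blast
      show "card {g \<in> M - K. w \<in> g} \<le> 2" for w
      proof -
        have "card {g \<in> M - K. w \<in> g} \<le> card {g \<in> M. w \<in> g}" using fin by (intro card_mono) auto
        then show ?thesis using deg[of w] by simp
      qed
      show "\<exists>w\<in>g. {h \<in> M - K. w \<in> h} = {g}" if "g \<in> M - K" for g
        using priv[of g] that by blast
    qed
    then obtain P where "path_decomposition (M - K) P" by blast
    then have "path_decomposition ((M - K) \<union> path_edges p) (insert p P)"
      using p by (intro path_decomposition_insert)
    moreover have "(M - K) \<union> path_edges p = M" using p(3) unfolding K_def by blast
    ultimately show ?thesis by metis
  qed
qed

text \<open>The edge \<open>e\<close> is kept by force, so it alone may lack an end of degree 1.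
  Each end of \<open>e\<close> carries at most one more edge, which leads to a leaf; thus the
  component of \<open>e\<close> is a path on at most four vertices, and removing it leaves a star
  forest.\<close>

lemma minimal_cover_decomposition:
  assumes fin: "finite M" and two: "\<And>f. f \<in> M \<Longrightarrow> card f = 2"
    and deg: "\<And>w. card {f \<in> M. w \<in> f} \<le> 2"
    and e: "e \<in> M" and priv: "\<And>f. f \<in> M \<Longrightarrow> f \<noteq> e \<Longrightarrow> \<exists>w\<in>f. {g \<in> M. w \<in> g} = {f}"
  shows "\<exists>P. path_decomposition M P"
proof -
  obtain x y where xy: "e = {x, y}" "x \<noteq> y" using two[OF e] by (auto simp: card_2_iff)
  define K where "K = {g \<in> M. g \<inter> e \<noteq> {}}"
  \<comment> \<open>The private end \<open>a\<close> of a second edge at \<open>z\<close> cannot lie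
    on \<open>e\<close>, since both ends of \<open>e\<close> are already covered by
    \<open>e\<close>.\<close>
  have ext: "{g \<in> M. z \<in> g} = {e} \<or>
      (\<exists>a. a \<notin> e \<and> {g \<in> M. z \<in> g} = {e, {z, a}} \<and> {g \<in> M. a \<in> g} = {{z, a}})" if z: "z \<in> e" for z
  proof (cases "{g \<in> M. z \<in> g} = {e}")
    case False
    then obtain g where g: "g \<in> M" "z \<in> g" "g \<noteq> e" using z e by blast
    obtain a where a: "a \<in> g" "{h \<in> M. a \<in> h} = {g}" using priv[of g] g by blast
    have ae: "a \<notin> e" using a(2) g(3) e by auto
    then have "g = {z, a}" using two[OF g(1)] a(1) g(2) z by (auto simp: card_2_iff)
    moreover have "{h \<in> M. z \<in> h} = {e, g}"
      using card_seteq[of "{h \<in> M. z \<in> h}" "{e, g}"] fin e z g deg[of z] by auto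
    ultimately show ?thesis using a ae by blast
  qed simp
  have Kx: "K = {g \<in> M. x \<in> g} \<union> {g \<in> M. y \<in> g}" using xy unfolding K_def by blast
  have "\<exists>p. distinct p \<and> 2 \<le> length p \<and> path_edges p = K \<and> set p \<inter> \<Union>(M - K) = {}"
  proof (cases "{g \<in> M. x \<in> g} = {e}")
    case X: True
    show ?thesis
    proof (cases "{g \<in> M. y \<in> g} = {e}")
      case True
      have "path_edges [x, y] = K" unfolding Kx X True using xy by simp
      moreover have "set [x, y] \<inter> \<Union>(M - K) = {}" using Kx by auto
      ultimately show ?thesis using xy(2)
        by (intro exI[of _ "[x, y]"]) (simp del: path_edges_simps)
    next
      case False
      then obtain b where b: "b \<notin> e" "{g \<in> M. y \<in> g} = {e, {y, b}}" "{g \<in> M. b \<in> g} = {{y, b}}"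
        using ext[of y] xy by blast
      have "path_edges [x, y, b] = K" unfolding Kx X b(2) using xy by auto
      moreover have "g \<in> K" if "g \<in> M" "x \<in> g \<or> y \<in> g \<or> b \<in> g" for g
        using that b Kx by blast
      then have "set [x, y, b] \<inter> \<Union>(M - K) = {}" by auto
      ultimately show ?thesis using xy b(1)
        by (intro exI[of _ "[x, y, b]"]) (simp del: path_edges_simps, blast)
    qed
  next
    case False
    then obtain a where a: "a \<notin> e" "{g \<in> M. x \<in> g} = {e, {x, a}}" "{g \<in> M. a \<in> g} = {{x, a}}"
      using ext[of x] xy by blast
    show ?thesis
    proof (cases "{g \<in> M. y \<in> g} = {e}")
      case True
      have "path_edges [a, x, y] = K" unfolding Kx a(2) True using xy by (simp add: insert_commute)
      moreover have "g \<in> K" if "g \<in> M" "x \<in> g \<or> y \<in> g \<or> a \<in> g" for g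
        using that a Kx by blast
      then have "set [a, x, y] \<inter> \<Union>(M - K) = {}" by auto
      ultimately show ?thesis using xy a(1)
        by (intro exI[of _ "[a, x, y]"]) (simp del: path_edges_simps)
    next
      case False
      then obtain b where b: "b \<notin> e" "{g \<in> M. y \<in> g} = {e, {y, b}}" "{g \<in> M. b \<in> g} = {{y, b}}"
        using ext[of y] xy by blast
      \<comment> \<open>A common neighbour would close a triangle, but \<open>a\<close> lies on a
        single edge.\<close>
      have "a \<noteq> b"
      proof
        assume "a = b"
        then have "{x, a} = {y, a}" using a(3) b(3) by (metis singleton_inject)
        then show False using xy(2) by (auto simp: doubleton_eq_iff)
      qed
      moreover have "path_edges [a, x, y, b] = K"
        unfolding Kx a(2) b(2) using xy by (simp add: insert_commute)
      moreover have "g \<in> K" if "g \<in> M" "x \<in> g \<or> y \<in> g \<or> a \<in> g \<or> b \<in> g" for g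
      proof -
        have "g \<in> {g \<in> M. x \<in> g} \<union> {g \<in> M. y \<in> g} \<union> {g \<in> M. a \<in> g} \<union> {g \<in> M. b \<in> g}"
          using that by simp
        then show ?thesis unfolding Kx a(2,3) b(2,3) by blast
      qed
      then have "set [a, x, y, b] \<inter> \<Union>(M - K) = {}" by auto
      ultimately show ?thesis using xy a(1) b(1)
        by (intro exI[of _ "[a, x, y, b]"]) (simp del: path_edges_simps, blast)
    qed
  qed
  then obtain p where p: "distinct p" "2 \<le> length p" "path_edges p = K"
      "set p \<inter> \<Union>(M - K) = {}" by blast
  have "\<exists>P. path_decomposition (M - K) P"
  proof (rule star_forest_decomposition)
    show "finite (M - K)" using fin by simp
    show "card g = 2" if "g \<in> M - K" for g using that two by blast
    show "card {g \<in> M - K. w \<in> g} \<le> 2" for w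
    proof -
      have "card {g \<in> M - K. w \<in> g} \<le> card {g \<in> M. w \<in> g}" using fin by (intro card_mono) auto
      then show ?thesis using deg[of w] by simp
    qed
    show "\<exists>w\<in>g. {h \<in> M - K. w \<in> h} = {g}" if "g \<in> M - K" for g
    proof -
      have "g \<noteq> e" using that e xy unfolding K_def by auto
      then show ?thesis using priv[of g] that by blast
    qed
  qed
  then obtain P where "path_decomposition (M - K) P" by blast
  then have "path_decomposition ((M - K) \<union> path_edges p) (insert p P)"
    using p by (intro path_decomposition_insert)
  moreover have "(M - K) \<union> path_edges p = M" using p(3) unfolding K_def by blast
  ultimately show ?thesis by metis
qed

lemma simple_graph_edge:
  assumes "simple_graph V E" and "f \<in> E"
  shows "card f = 2" and "f \<subseteq> V"
  using assms unfolding simple_graph_def by (fastforce simp: card_2_iff)+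

text \<open>Choose a smallest subset of \<open>F\<close> that contains \<open>e\<close> and covers
  \<open>V\<close>. An edge other than \<open>e\<close> without a private vertex could be dropped,
  so the previous decomposition applies.\<close>

lemma path_factor_of_edge_cover:
  assumes G: "simple_graph V E" and FE: "F \<subseteq> E" and eF: "e \<in> F"
    and cover: "\<And>w. w \<in> V \<Longrightarrow> \<exists>f\<in>F. w \<in> f"
    and deg: "\<And>w. card {f \<in> F. w \<in> f} \<le> 2"
  shows "\<exists>F'. is_P_ge_factor 2 V E F' \<and> e \<in> F'"
proof -
  define good where "good M \<longleftrightarrow> M \<subseteq> F \<and> e \<in> M \<and> V \<subseteq> \<Union>M" for M
  have finF: "finite F"
  proof (rule finite_subset)
    show "F \<subseteq> Pow V" using FE simple_graph_edge[OF G] by blast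
    show "finite (Pow V)" using G unfolding simple_graph_def by simp
  qed
  have "good F" using eF cover unfolding good_def by blast
  then obtain M where M: "good M" "\<And>N. card N < card M \<Longrightarrow> \<not> good N"
    using ex_has_least_nat[of good F card] by (metis not_le)
  have finM: "finite M" using M(1) finF finite_subset unfolding good_def by blast
  have "\<exists>P. path_decomposition M P"
  proof (rule minimal_cover_decomposition)
    show "finite M" by (fact finM)
    show "card f = 2" if "f \<in> M" for f
      using that M(1) FE simple_graph_edge[OF G] unfolding good_def by blast
    show "card {f \<in> M. w \<in> f} \<le> 2" for w
    proof -
      have "card {f \<in> M. w \<in> f} \<le> card {f \<in> F. w \<in> f}"
        using finF M(1) unfolding good_def by (intro card_mono) auto
      then show ?thesis using deg[of w] by simp
    qed
    show "e \<in> M" using M(1) unfolding good_def by simp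
    show "\<exists>w\<in>f. {g \<in> M. w \<in> g} = {f}" if f: "f \<in> M" "f \<noteq> e" for f
    proof -
      have "\<not> good (M - {f})" using f finM by (intro M(2) card_Diff1_less)
      then obtain w where "w \<in> V" "w \<notin> \<Union>(M - {f})" using f M(1) unfolding good_def by blast
      moreover have "w \<in> \<Union>M" using M(1) \<open>w \<in> V\<close> unfolding good_def by blast
      ultimately show ?thesis by blast
    qed
  qed
  then obtain P where P: "path_decomposition M P" by blast
  have "\<Union>M = V" using M(1) FE simple_graph_edge(2)[OF G] unfolding good_def by blast
  moreover have "M \<subseteq> E" using M(1) FE unfolding good_def by blast
  ultimately have "is_P_ge_factor 2 V E M"
    using P unfolding is_P_ge_factor_def path_decomposition_def is_path_in_def
    by (intro exI[of _ P]) auto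
  then show ?thesis using M(1) unfolding good_def by blast
qed

text \<open>The edge \<open>xy\<close> already uses one of the two places at \<open>x\<close> and at
  \<open>y\<close>, hence the capacity 1 there. Together with \<open>xy\<close>, the selected arcs
  form an edge cover of maximum degree at most 2.\<close>

lemma edge_in_path_factor_of_capacities:
  assumes G: "simple_graph V E" and e: "{x, y} \<in> E"
    and \<phi>: "\<And>u. u \<in> V - {x, y} \<Longrightarrow> adj E u (\<phi> u)"
    and cap: "\<And>w. card {u \<in> V - {x, y}. \<phi> u = w} \<le> (if w = x \<or> w = y then 1 else 2)"
  shows "\<exists>F. is_P_ge_factor 2 V E F \<and> {x, y} \<in> F"
proof -
  define U where "U = V - {x, y}"
  have finU: "finite U" using G unfolding U_def simple_graph_def by simp
  have edge: "{u, \<phi> u} \<in> E" if "u \<in> U" for u using \<phi> that unfolding U_def adj_def by blast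
  have inV: "\<phi> u \<in> V" if "u \<in> U" for u using edge[OF that] simple_graph_edge[OF G] by blast
  \<comment> \<open>Outside \<open>U\<close> the arc selection expects capacity 1; this concerns
    \<open>x\<close> and \<open>y\<close>, and also elements outside \<open>V\<close>, which receive
    no arcs at all.\<close>
  have capU: "card {u \<in> U. \<phi> u = w} \<le> (if w \<in> U then 2 else 1)" for w
  proof (cases "w \<in> V")
    case True
    then show ?thesis using cap[of w] unfolding U_def by auto
  next
    case False
    then have "{u \<in> U. \<phi> u = w} = {}" using inV by blast
    then show ?thesis by (simp only: card.empty)
  qed
  obtain D where D: "D \<subseteq> U" "\<And>u. u \<in> U \<Longrightarrow> u \<in> D \<or> u \<in> \<phi> ` D"
    "\<And>w. card {v \<in> D. \<phi> v = w} + (if w \<in> D then 1 else 0) \<le> (if w \<in> U then 2 else 1)"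
    using arc_selection[OF finU capU] by blast
  have finD: "finite D" using D(1) finU by (rule finite_subset)
  define F where "F = insert {x, y} ((\<lambda>u. {u, \<phi> u}) ` D)"
  show ?thesis
  proof (rule path_factor_of_edge_cover[OF G])
    show "F \<subseteq> E" using e edge D(1) unfolding F_def by blast
    show "{x, y} \<in> F" unfolding F_def by simp
    show "\<exists>f\<in>F. w \<in> f" if "w \<in> V" for w
      using that D(2)[of w] unfolding F_def U_def by blast
    show "card {f \<in> F. w \<in> f} \<le> 2" for w
    proof -
      \<comment> \<open>The tails of the selected arcs that enter or leave \<open>w\<close>.
        Opposite arcs give the same edge, so only an upper bound on the number of edges is
        claimed.\<close>
      define B where "B = {v \<in> D. \<phi> v = w} \<union> {v \<in> D. v = w}"
      have finB: "finite B" using finD unfolding B_def by simp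
      have "card {v \<in> D. v = w} = (if w \<in> D then 1 else 0)"
      proof -
        have "{v \<in> D. v = w} = (if w \<in> D then {w} else {})" by auto
        then show ?thesis by simp
      qed
      then have B: "card B \<le> (if w \<in> U then 2 else 1)"
        using D(3)[of w] card_Un_le[of "{v \<in> D. \<phi> v = w}" "{v \<in> D. v = w}"] unfolding B_def by simp
      have img: "card ((\<lambda>u. {u, \<phi> u}) ` B) \<le> card B" using finB by (rule card_image_le)
      have sub: "{f \<in> F. w \<in> f} \<subseteq> (if w \<in> {x, y} then {{x, y}} else {}) \<union> (\<lambda>u. {u, \<phi> u}) ` B"
        unfolding F_def B_def by auto
      show ?thesis
      proof (cases "w \<in> {x, y}")
        case True
        then have "card {f \<in> F. w \<in> f} \<le> card (insert {x, y} ((\<lambda>u. {u, \<phi> u}) ` B))"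
          using sub finB by (intro card_mono) auto
        also have "\<dots> \<le> 1 + card ((\<lambda>u. {u, \<phi> u}) ` B)" by (simp add: card_insert_le_m1 finB card_insert_if)
        finally show ?thesis using True img B unfolding U_def by auto
      next
        case False
        then have "card {f \<in> F. w \<in> f} \<le> card ((\<lambda>u. {u, \<phi> u}) ` B)"
          using sub finB by (intro card_mono) auto
        then show ?thesis using img B by (auto split: if_splits)
      qed
    qed
  qed
qed

section \<open>From a missing path factor to an independent set with few neighbours\<close>

text \<open>If no path factor contains \<open>xy\<close>, Hall's condition with capacities fails for
  some \<open>X\<close>. The set \<open>J\<close> consists of the vertices isolated within
  \<open>X\<close>, and \<open>S\<close> is its neighbourhood, nonempty because no vertex of the
  graph is isolated.\<close>

lemma not_covered_imp_large_independent_set: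
  assumes G: "simple_graph V E" and iso: "\<And>v. v \<in> V \<Longrightarrow> \<exists>u. adj E v u"
    and nc: "\<not> P_ge_factor_covered 2 V E"
  obtains S J where "S \<subseteq> V" "S \<noteq> {}" "J \<subseteq> V - S" "\<And>u v. u \<in> J \<Longrightarrow> adj E u v \<Longrightarrow> v \<in> S"
    "2 \<le> card J" "2 * card S \<le> card J + 1"
proof -
  have finV: "finite V" using G unfolding simple_graph_def by simp
  have sym: "adj E u v \<longleftrightarrow> adj E v u" for u v unfolding adj_def by (simp add: insert_commute)
  have adjV: "u \<in> V" "v \<in> V" if "adj E u v" for u v
    using that simple_graph_edge(2)[OF G] unfolding adj_def by blast+
  obtain e where e: "e \<in> E" "\<not> (\<exists>F. is_P_ge_factor 2 V E F \<and> e \<in> F)"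
    using nc unfolding P_ge_factor_covered_def by blast
  obtain x y where xy: "e = {x, y}" "x \<noteq> y" using simple_graph_edge[OF G e(1)] by (auto simp: card_2_iff)
  define N where "N u = {v. adj E u v}" for u
  define c :: "'a \<Rightarrow> nat" where "c w = (if w = x \<or> w = y then 1 else 2)" for w
  have NV: "N u \<subseteq> V" for u using adjV unfolding N_def by blast
  have finN: "finite (N u)" for u using NV finV by (rule finite_subset)
  have "\<exists>X\<subseteq>V - {x, y}. sum c (\<Union>(N ` X)) < card X"
  proof (rule ccontr)
    assume "\<not> ?thesis"
    then have H: "card X \<le> sum c (\<Union>(N ` X))" if "X \<subseteq> V - {x, y}" for X using that by (meson not_le)
    have "finite (V - {x, y})" using finV by simp
    then obtain \<phi> where \<phi>: "\<And>u. u \<in> V - {x, y} \<Longrightarrow> \<phi> u \<in> N u"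
      "\<And>w. card {u \<in> V - {x, y}. \<phi> u = w} \<le> c w"
      using hall_with_capacities[of "V - {x, y}" N c] finN H by blast
    have "\<exists>F. is_P_ge_factor 2 V E F \<and> {x, y} \<in> F"
    proof (rule edge_in_path_factor_of_capacities[OF G])
      show "{x, y} \<in> E" using e xy by simp
      show "adj E u (\<phi> u)" if "u \<in> V - {x, y}" for u using \<phi>(1)[OF that] unfolding N_def by simp
      show "card {u \<in> V - {x, y}. \<phi> u = w} \<le> (if w = x \<or> w = y then 1 else 2)" for w
        using \<phi>(2)[of w] unfolding c_def by simp
    qed
    then show False using e(2) xy by blast
  qed
  then obtain X where X: "X \<subseteq> V - {x, y}" "sum c (\<Union>(N ` X)) < card X" by blast
  \<comment> \<open>Vertices of \<open>X\<close> with a neighbour in \<open>X\<close> lie in \<open>N(X)\<close> themselves, so they cannot cause the deficit.\<close>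
  define J where "J = {v \<in> X. N v \<inter> X = {}}"
  define S where "S = \<Union>(N ` J)"
  have finX: "finite X" using X(1) finV by (meson finite_Diff finite_subset)
  have finS: "finite S" unfolding S_def J_def using finX finN by simp
  have SX: "S \<inter> X = {}" unfolding S_def J_def by blast
  \<comment> \<open>\<open>S\<close> and \<open>X - J\<close> are disjoint parts of the
    neighbourhood of \<open>X\<close>, and the capacity of \<open>X - J\<close> is at least its
    size; cancelling it leaves the whole deficit on \<open>J\<close>.\<close>
  have big: "sum c S + 1 \<le> card J"
  proof -
    have "S \<union> (X - J) \<subseteq> \<Union>(N ` X)"
    proof
      fix w assume "w \<in> S \<union> (X - J)"
      then show "w \<in> \<Union>(N ` X)"
      proof
        assume "w \<in> S" then show ?thesis unfolding S_def J_def by blast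
      next
        assume "w \<in> X - J"
        then obtain z where "z \<in> N w" "z \<in> X" unfolding J_def by blast
        then show ?thesis using sym unfolding N_def by blast
      qed
    qed
    then have "sum c (S \<union> (X - J)) \<le> sum c (\<Union>(N ` X))"
      using finX finN by (intro sum_mono2) auto
    moreover have "sum c (S \<union> (X - J)) = sum c S + sum c (X - J)"
      using finS finX SX by (intro sum.union_disjoint) auto
    moreover have "card (X - J) \<le> sum c (X - J)"
      using sum_mono[of "X - J" "\<lambda>_. 1" c] unfolding c_def by simp
    moreover have "card X = card J + card (X - J)"
      using finX card_Un_disjoint[of J "X - J"] unfolding J_def
      by (metis (no_types, lifting) Diff_disjoint Diff_partition finite_Diff finite_subset mem_Collect_eq subsetI)
    ultimately show ?thesis using X(2) by linarith
  qed
  then have "J \<noteq> {}" by (metis add_leD2 card.empty not_one_le_zero)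
  then obtain v where v: "v \<in> J" by blast
  then have "v \<in> V" using X(1) unfolding J_def by blast
  then obtain u where "adj E v u" using iso by blast
  then have Sne: "S \<noteq> {}" using v unfolding S_def N_def by blast
  have c1: "card S \<le> sum c S"
    using sum_mono[of S "\<lambda>_. 1" c] unfolding c_def by simp
  \<comment> \<open>Only \<open>x\<close> and \<open>y\<close> fall short of capacity 2, each by
    one.\<close>
  have "2 * card S \<le> sum c S + 2"
  proof -
    have "2 * card S = (\<Sum>w\<in>S. 2)" by simp
    also have "\<dots> \<le> (\<Sum>w\<in>S. c w + of_bool (w = x) + of_bool (w = y))"
      by (intro sum_mono) (auto simp: c_def)
    also have "\<dots> = sum c S + (of_bool (x \<in> S) + of_bool (y \<in> S))"
      using finS by (simp add: sum.distrib sum.delta of_bool_def)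
    finally show ?thesis by (auto simp: of_bool_def split: if_splits)
  qed
  then have "2 * card S \<le> card J + 1" using big by linarith
  \<comment> \<open>This adds information when \<open>S\<close> is a single vertex, where
    \<open>2 * card S \<le> card J + 1\<close> yields only one vertex in \<open>J\<close>.\<close>
  moreover have "2 \<le> card J"
    using big c1 Sne finS by (metis One_nat_def Suc_leI add_leD2 add_mono card_gt_0_iff le_trans one_add_one order_refl)
  moreover have "J \<subseteq> V - S" using X(1) SX unfolding J_def by blast
  moreover have "S \<subseteq> V" using NV unfolding S_def by blast
  moreover have "v \<in> S" if "u \<in> J" "adj E u v" for u v using that unfolding S_def N_def by blast
  ultimately show thesis using Sne by (intro that)
qed

subsection \<open>Bounding the eigenvalues\<close>

text \<open>A Collatz-Wielandt argument: compare an eigenvector \<open>x\<close> with the positive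
  supersolution \<open>y\<close> at a vertex \<open>w\<close> where the ratio of
  \<open>\<bar>x v\<bar>\<close> to \<open>y v\<close> is largest.\<close>

lemma is_eigenvalue_imp_le:
  assumes fin: "finite V" and nonneg: "\<And>u v. u \<in> V \<Longrightarrow> v \<in> V \<Longrightarrow> 0 \<le> M u v"
    and pos: "\<And>u. u \<in> V \<Longrightarrow> 0 < y u"
    and le: "\<And>u. u \<in> V \<Longrightarrow> (\<Sum>v\<in>V. M u v * y v) \<le> L * y u"
    and ev: "is_eigenvalue V M mu"
  shows "mu \<le> L"
proof -
  obtain x v0 where v0: "v0 \<in> V" "x v0 \<noteq> 0"
    and x: "\<And>u. u \<in> V \<Longrightarrow> (\<Sum>v\<in>V. M u v * x v) = mu * x u"
    using ev unfolding is_eigenvalue_def by blast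
  define r where "r v = \<bar>x v\<bar> / y v" for v
  have "Max (r ` V) \<in> r ` V" using fin v0(1) by (intro Max_in) auto
  then obtain w where w: "w \<in> V" "r w = Max (r ` V)" by force
  have rw: "r v \<le> r w" if "v \<in> V" for v using that fin w(2) by simp
  have "0 < r v0" using v0 pos unfolding r_def by simp
  then have rpos: "0 < r w" using rw[OF v0(1)] by linarith
  have xle: "\<bar>x v\<bar> \<le> r w * y v" if "v \<in> V" for v
    using rw[OF that] pos[OF that] unfolding r_def[of v] by (simp add: field_simps)
  have xw: "\<bar>x w\<bar> = r w * y w" using pos[OF w(1)] unfolding r_def by simp
  have "mu * \<bar>x w\<bar> \<le> \<bar>mu * x w\<bar>" by (simp add: abs_mult mult_right_mono)
  also have "\<dots> \<le> (\<Sum>v\<in>V. \<bar>M w v * x v\<bar>)" unfolding x[OF w(1), symmetric] by (rule sum_abs)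
  also have "\<dots> \<le> (\<Sum>v\<in>V. r w * (M w v * y v))"
  proof (rule sum_mono)
    fix v assume v: "v \<in> V"
    have "\<bar>M w v * x v\<bar> = M w v * \<bar>x v\<bar>" using nonneg[OF w(1) v] by (simp add: abs_mult)
    also have "\<dots> \<le> M w v * (r w * y v)" using nonneg[OF w(1) v] xle[OF v] by (rule mult_left_mono[rotated])
    finally show "\<bar>M w v * x v\<bar> \<le> r w * (M w v * y v)" by (simp add: mult_ac)
  qed
  also have "\<dots> = r w * (\<Sum>v\<in>V. M w v * y v)" by (simp add: sum_distrib_left)
  also have "\<dots> \<le> r w * (L * y w)" using le[OF w(1)] rpos by simp
  also have "\<dots> = L * \<bar>x w\<bar>" using xw by simp
  finally show ?thesis using xw rpos pos[OF w(1)] by (simp add: mult_le_cancel_right)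
qed

text \<open>Grouping the degree term with the adjacency term gives one summand per neighbour. For
  positive weights and \<alpha> in the unit interval the summands are nonnegative, so enlarging a
  neighbourhood never decreases the sum.\<close>

lemma A_alpha_row_sum:
  assumes G: "simple_graph V E" and u: "u \<in> V"
  shows "(\<Sum>v\<in>V. A_alpha \<alpha> V E u v * y v) = (\<Sum>v\<in>{v\<in>V. adj E u v}. \<alpha> * y u + (1 - \<alpha>) * y v)"
proof -
  have fin: "finite V" using G unfolding simple_graph_def by simp
  have deg: "Defs.degree V E u = card {v\<in>V. adj E u v}"
    unfolding Defs.degree_def adj_def by (simp add: insert_commute)
  have "(\<Sum>v\<in>V. A_alpha \<alpha> V E u v * y v) =
      (\<Sum>v\<in>V. (if v = u then \<alpha> * real (Defs.degree V E u) * y v else 0) +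
        (if adj E u v then (1 - \<alpha>) * y v else 0))"
    unfolding A_alpha_def by (intro sum.cong) (auto simp: algebra_simps)
  also have "\<dots> = \<alpha> * real (Defs.degree V E u) * y u + (\<Sum>v\<in>{v\<in>V. adj E u v}. (1 - \<alpha>) * y v)"
    using fin u by (simp add: sum.distrib sum.delta sum.inter_filter)
  finally show ?thesis by (simp add: sum.distrib deg)
qed

text \<open>
  The three inequalities say that the weights \<open>a\<close>, \<open>b\<close>, \<open>c\<close> form a supersolution for
  \<open>K_s \<or> (K_m \<union> tK_1)\<close>, which contains the graph.
\<close>

lemma eigenvalue_le_of_join_weights:
  assumes G: "simple_graph V E" and \<alpha>: "0 \<le> \<alpha>" "\<alpha> \<le> 1"
    and SJ: "S \<subseteq> V" "J \<subseteq> V - S" and nb: "\<And>u v. u \<in> J \<Longrightarrow> adj E u v \<Longrightarrow> v \<in> S"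
    and card: "s = real (card S)" "t = real (card J)" "real (card V) = s + t + m"
    and pos: "0 < a" "0 < b" "0 < c"
    and indep: "s * (\<alpha> * c + (1 - \<alpha>) * a) \<le> L * c"
    and clique: "s * (\<alpha> * b + (1 - \<alpha>) * a) + (m - 1) * b \<le> L * b"
    and core: "(s - 1) * a + m * (\<alpha> * a + (1 - \<alpha>) * b) + t * (\<alpha> * a + (1 - \<alpha>) * c) \<le> L * a"
    and ev: "is_eigenvalue V (A_alpha \<alpha> V E) mu"
  shows "mu \<le> L"
proof (rule is_eigenvalue_imp_le[OF _ _ _ _ ev])
  define R where "R = V - S - J"
  define y where "y v = (if v \<in> S then a else if v \<in> J then c else b)" for v
  show fin: "finite V" using G unfolding simple_graph_def by simp
  have finS: "finite S" and finJ: "finite J" and finR: "finite R"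
    using fin SJ unfolding R_def by (auto intro: finite_subset)
  have V: "V = S \<union> (R \<union> J)" and disj: "S \<inter> (R \<union> J) = {}" "R \<inter> J = {}"
    using SJ unfolding R_def by auto
  have m: "m = real (card R)"
    using card V disj finS finJ finR by (simp add: card_Un_disjoint)
  show "0 \<le> A_alpha \<alpha> V E u v" for u v using \<alpha> unfolding A_alpha_def by simp
  show ypos: "0 < y u" for u using pos unfolding y_def by simp
  have irr: "\<not> adj E u u" for u
    using G unfolding simple_graph_def adj_def by (metis doubleton_eq_iff)
  show "(\<Sum>v\<in>V. A_alpha \<alpha> V E u v * y v) \<le> L * y u" if u: "u \<in> V" for u
  proof -
    let ?g = "\<lambda>v. \<alpha> * y u + (1 - \<alpha>) * y v"
    have le: "(\<Sum>v\<in>V. A_alpha \<alpha> V E u v * y v) \<le> sum ?g B"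
      if "finite B" "{v\<in>V. adj E u v} \<subseteq> B" for B
      unfolding A_alpha_row_sum[OF G u]
      using that \<alpha> ypos[THEN less_imp_le] by (intro sum_mono2) auto
    have gS: "sum ?g S = s * (\<alpha> * y u + (1 - \<alpha>) * a)" unfolding y_def card(1) by simp
    have gR: "sum ?g R = m * (\<alpha> * y u + (1 - \<alpha>) * b)"
    proof -
      have "sum ?g R = (\<Sum>v\<in>R. \<alpha> * y u + (1 - \<alpha>) * b)"
        unfolding y_def R_def by (intro sum.cong) auto
      then show ?thesis unfolding m by simp
    qed
    have gJ: "sum ?g J = t * (\<alpha> * y u + (1 - \<alpha>) * c)"
    proof -
      have "sum ?g J = (\<Sum>v\<in>J. \<alpha> * y u + (1 - \<alpha>) * c)"
        using SJ unfolding y_def by (intro sum.cong) auto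
      then show ?thesis unfolding card(2) by simp
    qed
    consider "u \<in> J" | "u \<in> R" | "u \<in> S" using u V by blast
    then show ?thesis
    proof cases
      case 1
      then have "y u = c" using SJ unfolding y_def by auto
      moreover have "{v\<in>V. adj E u v} \<subseteq> S" using nb 1 by blast
      ultimately show ?thesis using le[OF finS] gS indep by simp
    next
      case 2
      then have yu: "y u = b" unfolding y_def R_def by auto
      have "{v\<in>V. adj E u v} \<subseteq> S \<union> (R - {u})"
      proof
        fix v assume v: "v \<in> {v\<in>V. adj E u v}"
        have "adj E v u" using v unfolding adj_def by (simp add: insert_commute)
        then have "v \<notin> J" using nb 2 unfolding R_def by blast
        moreover have "v \<noteq> u" using v irr by blast
        ultimately show "v \<in> S \<union> (R - {u})" using v unfolding R_def by blast
      qed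
      moreover have "sum ?g (S \<union> (R - {u})) = sum ?g S + (sum ?g R - ?g u)"
      proof -
        have "sum ?g (S \<union> (R - {u})) = sum ?g S + sum ?g (R - {u})"
          using finS finR disj by (intro sum.union_disjoint) auto
        moreover have "sum ?g (R - {u}) = sum ?g R - ?g u"
          using sum_diff1[OF finR, of ?g u] 2 by (simp only: if_True)
        ultimately show ?thesis by simp
      qed
      ultimately have "(\<Sum>v\<in>V. A_alpha \<alpha> V E u v * y v) \<le> sum ?g S + (sum ?g R - ?g u)"
        using le[of "S \<union> (R - {u})"] finS finR by simp
      also have "\<dots> = s * (\<alpha> * b + (1 - \<alpha>) * a) + (m - 1) * b"
        unfolding gS gR by (simp add: yu algebra_simps)
      finally show ?thesis using clique yu by simp
    next
      case 3
      then have yu: "y u = a" unfolding y_def by simp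
      have "{v\<in>V. adj E u v} \<subseteq> (S - {u}) \<union> (R \<union> J)" using irr V by blast
      moreover have "sum ?g ((S - {u}) \<union> (R \<union> J)) = (sum ?g S - ?g u) + (sum ?g R + sum ?g J)"
      proof -
        have "sum ?g ((S - {u}) \<union> (R \<union> J)) = sum ?g (S - {u}) + sum ?g (R \<union> J)"
          using finS finR finJ disj by (intro sum.union_disjoint) auto
        moreover have "sum ?g (R \<union> J) = sum ?g R + sum ?g J"
          using finR finJ disj by (intro sum.union_disjoint) auto
        moreover have "sum ?g (S - {u}) = sum ?g S - ?g u"
          using sum_diff1[OF finS, of ?g u] 3 by (simp only: if_True)
        ultimately show ?thesis by simp
      qed
      ultimately have "(\<Sum>v\<in>V. A_alpha \<alpha> V E u v * y v) \<le> (sum ?g S - ?g u) + (sum ?g R + sum ?g J)"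
        using le[of "(S - {u}) \<union> (R \<union> J)"] finS finR finJ by simp
      also have "\<dots> = (s - 1) * a + m * (\<alpha> * a + (1 - \<alpha>) * b) + t * (\<alpha> * a + (1 - \<alpha>) * c)"
        unfolding gS gR gJ by (simp add: yu algebra_simps)
      finally show ?thesis using core yu by simp
    qed
  qed
qed

section \<open>Existence of real eigenvalues\<close>

text \<open>Needed for the \<open>Max\<close> in \<open>rho_alpha\<close> to be attained. The matrix
  is transferred to a complex \<open>n\<close> by \<open>n\<close> matrix, whose spectrum is finite
  and nonempty; symmetry makes its eigenvalues real, and a real eigenvector is the real or the
  imaginary part of a complex one.\<close>

lemma symmetric_eigenvalues_finite_nonempty:
  assumes fin: "finite V" and ne: "V \<noteq> {}" and sym: "\<And>u v. u \<in> V \<Longrightarrow> v \<in> V \<Longrightarrow> M u v = M v u"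
  shows "finite {mu. is_eigenvalue V M mu}" and "{mu. is_eigenvalue V M mu} \<noteq> {}"
proof -
  define n where "n = card V"
  obtain g where g: "bij_betw g {0..<n} V"
    using ex_bij_betw_nat_finite[OF fin] unfolding n_def by blast
  define A where "A = mat n n (\<lambda>(i, j). complex_of_real (M (g i) (g j)))"
  have A: "A \<in> carrier_mat n n" unfolding A_def by simp
  have gV: "g i \<in> V" if "i < n" for i using g that unfolding bij_betw_def by auto
  have reindex: "(\<Sum>v\<in>V. F v) = (\<Sum>i\<in>{0..<n}. F (g i))" for F :: "'a \<Rightarrow> 'c::comm_monoid_add"
    using sum.reindex_bij_betw[OF g, of F] by simp
  have row: "(A *\<^sub>v w) $ i = (\<Sum>j\<in>{0..<n}. complex_of_real (M (g i) (g j)) * w $ j)"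
    if "w \<in> carrier_vec n" "i < n" for w i
    using that unfolding A_def by (simp add: scalar_prod_def)
  have "complex_of_real ` {mu. is_eigenvalue V M mu} \<subseteq> spectrum A"
  proof clarify
    fix mu assume "is_eigenvalue V M mu"
    then obtain x v0 where v0: "v0 \<in> V" "x v0 \<noteq> 0"
      and x: "\<And>u. u \<in> V \<Longrightarrow> (\<Sum>v\<in>V. M u v * x v) = mu * x u"
      unfolding is_eigenvalue_def by blast
    define w where "w = vec n (\<lambda>i. complex_of_real (x (g i)))"
    have w: "w \<in> carrier_vec n" unfolding w_def by simp
    obtain i where i: "i < n" "g i = v0" using g v0(1) unfolding bij_betw_def by force
    have "w \<noteq> 0\<^sub>v n"
    proof
      assume "w = 0\<^sub>v n"
      then have "w $ i = 0" using i by simp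
      then show False using i v0 unfolding w_def by simp
    qed
    moreover have "A *\<^sub>v w = complex_of_real mu \<cdot>\<^sub>v w"
    proof (rule eq_vecI)
      show "dim_vec (A *\<^sub>v w) = dim_vec (complex_of_real mu \<cdot>\<^sub>v w)" using A w by simp
      fix i assume "i < dim_vec (complex_of_real mu \<cdot>\<^sub>v w)"
      then have i: "i < n" using w by simp
      have "(A *\<^sub>v w) $ i = complex_of_real (\<Sum>j\<in>{0..<n}. M (g i) (g j) * x (g j))"
        unfolding row[OF w i] unfolding w_def by simp
      also have "\<dots> = complex_of_real (mu * x (g i))"
        using x[OF gV[OF i]] unfolding reindex by simp
      finally show "(A *\<^sub>v w) $ i = (complex_of_real mu \<cdot>\<^sub>v w) $ i"
        using i unfolding w_def by simp
    qed
    ultimately show "complex_of_real mu \<in> spectrum A"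
      using w A unfolding spectrum_def eigenvalue_def eigenvector_def by auto
  qed
  then have "finite (complex_of_real ` {mu. is_eigenvalue V M mu})"
    using card_finite_spectrum(1)[OF A] by (rule finite_subset)
  then show "finite {mu. is_eigenvalue V M mu}"
    by (rule finite_imageD) (simp add: inj_on_def)
  have "n > 0" using fin ne unfolding n_def by (simp add: card_gt_0_iff)
  then obtain k where "k \<in> spectrum A" using spectrum_non_empty[OF A] by blast
  then obtain w where w: "w \<in> carrier_vec n" "w \<noteq> 0\<^sub>v n" "A *\<^sub>v w = k \<cdot>\<^sub>v w"
    using A unfolding spectrum_def eigenvalue_def eigenvector_def by auto
  define z where "z i = w $ i" for i
  have eq: "(\<Sum>j\<in>{0..<n}. complex_of_real (M (g i) (g j)) * z j) = k * z i" if "i < n" for i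
    using row[OF w(1) that] w that unfolding z_def by simp
  have "\<exists>i<n. z i \<noteq> 0"
  proof (rule ccontr)
    assume "\<not> ?thesis"
    then have "w = 0\<^sub>v n" using w(1) unfolding z_def by (intro eq_vecI) auto
    then show False using w(2) by simp
  qed
  then obtain i0 where i0: "i0 < n" "z i0 \<noteq> 0" by blast
  \<comment> \<open>The Hermitian form at \<open>z\<close>: the eigenvector equation makes it
    \<open>k\<close> times the squared norm \<open>nz\<close>, and symmetry of \<open>M\<close>
    makes it its own conjugate, so \<open>k\<close> is real.\<close>
  define Q where "Q = (\<Sum>i\<in>{0..<n}. cnj (z i) * (\<Sum>j\<in>{0..<n}. complex_of_real (M (g i) (g j)) * z j))"
  define nz where "nz = (\<Sum>i\<in>{0..<n}. (cmod (z i))\<^sup>2)"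
  have "nz > 0" unfolding nz_def using i0 by (intro sum_pos2[of _ i0]) auto
  have "Q = k * complex_of_real nz"
  proof -
    have "Q = (\<Sum>i\<in>{0..<n}. k * complex_of_real ((cmod (z i))\<^sup>2))"
      unfolding Q_def
    proof (rule sum.cong)
      fix i assume "i \<in> {0..<n}"
      then show "cnj (z i) * (\<Sum>j\<in>{0..<n}. complex_of_real (M (g i) (g j)) * z j) =
          k * complex_of_real ((cmod (z i))\<^sup>2)"
        using eq[of i] complex_norm_square[of "z i"] by (simp add: mult_ac)
    qed simp
    then show ?thesis unfolding nz_def by (simp add: sum_distrib_left)
  qed
  moreover have "cnj Q = Q"
  proof -
    have "cnj Q = (\<Sum>i\<in>{0..<n}. \<Sum>j\<in>{0..<n}. z i * complex_of_real (M (g i) (g j)) * cnj (z j))"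
      unfolding Q_def by (simp add: sum_distrib_left mult_ac)
    also have "\<dots> = (\<Sum>j\<in>{0..<n}. \<Sum>i\<in>{0..<n}. z i * complex_of_real (M (g i) (g j)) * cnj (z j))"
      by (rule sum.swap)
    also have "\<dots> = Q"
      unfolding Q_def sum_distrib_left
      by (intro sum.cong refl) (simp add: sym[OF gV gV] mult_ac)
    finally show ?thesis .
  qed
  ultimately have "cnj k = k" using \<open>nz > 0\<close> by simp
  then have k: "k = complex_of_real (Re k)" by (simp add: complex_eq_iff)
  have Re_eq: "(\<Sum>j\<in>{0..<n}. M (g i) (g j) * Re (z j)) = Re k * Re (z i)"
    and Im_eq: "(\<Sum>j\<in>{0..<n}. M (g i) (g j) * Im (z j)) = Re k * Im (z i)" if "i < n" for i
    using arg_cong[OF eq[OF that], of Re] arg_cong[OF eq[OF that], of Im]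
    by (subst (asm) (1 2) k, simp)+
  define h where "h = inv_into {0..<n} g"
  have hg: "h (g i) = i" if "i < n" for i
    using g that unfolding h_def bij_betw_def by (simp add: inv_into_f_f)
  have eigen: "is_eigenvalue V M (Re k)"
    if x: "\<And>i. i < n \<Longrightarrow> (\<Sum>j\<in>{0..<n}. M (g i) (g j) * x j) = Re k * x i" and "x i0 \<noteq> 0"
    for x :: "nat \<Rightarrow> real"
    unfolding is_eigenvalue_def
  proof (intro exI[of _ "x \<circ> h"] conjI ballI)
    show "\<exists>v\<in>V. (x \<circ> h) v \<noteq> 0" using that(2) gV[OF i0(1)] hg[OF i0(1)] by (intro bexI[of _ "g i0"]) auto
    fix u assume "u \<in> V"
    then obtain i where i: "i < n" "u = g i" using g unfolding bij_betw_def by force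
    show "(\<Sum>v\<in>V. M u v * (x \<circ> h) v) = Re k * (x \<circ> h) u"
      using x[OF i(1)] i hg unfolding reindex by simp
  qed
  \<comment> \<open>Both parts satisfy the real eigenvector equation; whichever does not vanish at
    \<open>i0\<close> is a genuine eigenvector.\<close>
  have "Re (z i0) \<noteq> 0 \<or> Im (z i0) \<noteq> 0" using i0(2) by (simp add: complex_eq_iff)
  then have "is_eigenvalue V M (Re k)"
    using eigen[of "\<lambda>i. Re (z i)"] eigen[of "\<lambda>i. Im (z i)"] Re_eq Im_eq by blast
  then show "{mu. is_eigenvalue V M mu} \<noteq> {}" by blast
qed

lemma rho_alpha_is_eigenvalue:
  assumes "simple_graph V E" and "V \<noteq> {}"
  shows "is_eigenvalue V (A_alpha \<alpha> V E) (rho_alpha \<alpha> V E)"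
proof -
  have "A_alpha \<alpha> V E u v = A_alpha \<alpha> V E v u" for u v
    unfolding A_alpha_def adj_def by (auto simp: insert_commute)
  moreover have "finite V" using assms(1) unfolding simple_graph_def by simp
  ultimately show ?thesis
    using Max_in[of "{mu. is_eigenvalue V (A_alpha \<alpha> V E) mu}"]
      symmetric_eigenvalues_finite_nonempty[of V "A_alpha \<alpha> V E"] assms(2)
    unfolding rho_alpha_def by blast
qed

section \<open>The cubic and its largest root\<close>

text \<open>The right side is the expanded determinant of the quotient matrix of
  \<open>K_1 \<or> (K_{n-3} \<union> 2K_1)\<close>, with diagonal entries
  \<open>\<alpha> * (n - 1)\<close> for the centre, \<open>n - 4 + \<alpha>\<close> for the clique
  and \<open>\<alpha>\<close> for the two leaves.\<close>

lemma eta_poly_quotient_form: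
  "eta_poly \<alpha> n x = (x - \<alpha> * (n - 1)) * ((x - \<alpha>) * (x - n + 4 - \<alpha>)) -
     (1 - \<alpha>)\<^sup>2 * ((n - 3) * (x - \<alpha>) + 2 * (x - n + 4 - \<alpha>))"
  unfolding eta_poly_def by (simp add: algebra_simps power2_eq_square power3_eq_cube)

text \<open>The cubic is negative at \<open>n - 3\<close> and positive at \<open>n - 1\<close>, so
  it has a root in between. Being monic it has finitely many roots, so the maximum is itself a root
  and at least that one.\<close>

lemma eta_root:
  assumes \<alpha>: "0 \<le> \<alpha>" "\<alpha> < 1" and n: "4 \<le> n"
  shows "eta_poly \<alpha> n (eta \<alpha> n) = 0" and "n - 3 < eta \<alpha> n"
proof -
  define p where "p = [: - (\<alpha> ^ 2) * n ^ 2 + (5 * \<alpha> ^ 2 - 3 * \<alpha> + 2) * n - 10 * \<alpha> ^ 2 + 15 * \<alpha> - 8,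
    \<alpha> * n ^ 2 + (\<alpha> ^ 2 - 2 * \<alpha> - 1) * n - 2 * \<alpha> + 1, - ((\<alpha> + 1) * n + \<alpha> - 4), 1:]"
  have p: "eta_poly \<alpha> n x = poly p x" for x
    unfolding eta_poly_def p_def by (simp add: algebra_simps power2_eq_square power3_eq_cube)
  have "p \<noteq> 0" unfolding p_def by simp
  then have fin: "finite {x. eta_poly \<alpha> n x = 0}" unfolding p by (rule poly_roots_finite)
  have "eta_poly \<alpha> n (n - 3) = - (1 - \<alpha>) * (2 * \<alpha> * (n - 3 - \<alpha>) + 2 * (1 - \<alpha>)\<^sup>2)"
    unfolding eta_poly_quotient_form by (simp add: algebra_simps power2_eq_square)
  moreover have "0 < 2 * \<alpha> * (n - 3 - \<alpha>) + 2 * (1 - \<alpha>)\<^sup>2"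
    using \<alpha> n by (intro add_nonneg_pos mult_nonneg_nonneg) auto
  ultimately have neg: "eta_poly \<alpha> n (n - 3) < 0" using \<alpha> by (simp add: mult_neg_pos)
  have "eta_poly \<alpha> n (n - 1) = (1 - \<alpha>) * ((n - 1 - \<alpha>) * (2 * n - 2 * \<alpha>) - 2 * (1 - \<alpha>) * (3 - \<alpha>))"
    unfolding eta_poly_quotient_form by (simp add: algebra_simps power2_eq_square)
  moreover have "2 * (1 - \<alpha>) * (3 - \<alpha>) < (n - 1 - \<alpha>) * (2 * n - 2 * \<alpha>)"
  proof -
    have "2 * (1 - \<alpha>) * (3 - \<alpha>) \<le> (2 * 1) * 3" using \<alpha> by (intro mult_mono) auto
    also have "\<dots> < 2 * 6" by simp
    also have "\<dots> \<le> (n - 1 - \<alpha>) * (2 * n - 2 * \<alpha>)" using \<alpha> n by (intro mult_mono) auto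
    finally show ?thesis .
  qed
  ultimately have pos: "0 < eta_poly \<alpha> n (n - 1)" using \<alpha> by simp
  have "continuous_on {n - 3..n - 1} (\<lambda>x. eta_poly \<alpha> n x)"
    unfolding eta_poly_def by (intro continuous_intros)
  then obtain x where x: "n - 3 \<le> x" "eta_poly \<alpha> n x = 0"
    using IVT'[of "\<lambda>x. eta_poly \<alpha> n x" "n - 3" 0 "n - 1"] neg pos by auto
  have "eta \<alpha> n \<in> {x. eta_poly \<alpha> n x = 0}" unfolding eta_def using fin x by (intro Max_in) auto
  then show root: "eta_poly \<alpha> n (eta \<alpha> n) = 0" by simp
  have "x \<le> eta \<alpha> n" unfolding eta_def using fin x by simp
  moreover have "eta \<alpha> n \<noteq> n - 3" using root neg by auto
  ultimately show "n - 3 < eta \<alpha> n" using x(1) by simp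
qed

section \<open>The numerical inequality for at least two vertices in \<open>S\<close>\<close>

text \<open>Replacing \<open>b\<close>, \<open>c\<close> and \<open>2 / \<beta>\<close> by their
  upper bounds \<open>B\<close>, \<open>s / C\<close> and \<open>q\<close> leaves an inequality in
  \<open>s\<close> and \<open>m\<close> that is free of \<beta>.\<close>

lemma join_weight_inequality_of_bounds:
  fixes s m \<beta> b c B C q :: real
  assumes "2 \<le> s" "0 \<le> m" "b \<le> B" "0 < C" "c \<le> s / C" "2 / \<beta> \<le> q"
    and "s * (2 * s - 1) \<le> C * ((1 - B) * m + (2 * s - 1) - q)"
  shows "m * b + (2 * s - 1) * c + 2 / \<beta> \<le> m + (2 * s - 1)"
proof -
  have "m * b \<le> m * B" using assms by (intro mult_left_mono)
  moreover have "(2 * s - 1) * c \<le> (2 * s - 1) * (s / C)" using assms by (intro mult_left_mono) auto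
  moreover have "(2 * s - 1) * (s / C) \<le> (1 - B) * m + (2 * s - 1) - q"
    using assms by (simp add: field_simps)
  ultimately show ?thesis using assms(6) by (simp add: algebra_simps)
qed

text \<open>
  With \<open>a = 1\<close>, the weights \<open>b\<close> and \<open>c\<close> that turn the first two inequalities into equalities for
  \<open>L = n - 3\<close> reduce the third one to the following.
\<close>

lemma join_weight_inequality:
  fixes s m \<alpha> :: real
  assumes \<alpha>: "0 \<le> \<alpha>" "\<alpha> < 1" and s: "2 \<le> s" and m: "0 \<le> m"
    and n: "f_bound \<alpha> \<le> 3 * s - 1 + m"
  shows "m * ((1 - \<alpha>) * s / ((3 - \<alpha>) * s - 3)) +
    (2 * s - 1) * ((1 - \<alpha>) * s / (3 * s - 4 + m - \<alpha> * s)) + 2 / (1 - \<alpha>) \<le> m + (2 * s - 1)"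
proof -
  define \<beta> where "\<beta> = 1 - \<alpha>"
  have \<beta>: "0 < \<beta>" "\<beta> \<le> 1" and \<alpha>\<beta>: "\<alpha> = 1 - \<beta>" using \<alpha> unfolding \<beta>_def by auto
  define b where "b = \<beta> * s / ((2 + \<beta>) * s - 3)"
  define c where "c = \<beta> * s / (2 * s - 4 + m + \<beta> * s)"
  have \<beta>s: "0 < \<beta> * s" using \<beta> s by simp
  \<comment> \<open>\<open>b\<close> decreases in \<open>s\<close>, so the worst case is
    \<open>s = 2\<close>, where it equals \<open>2 * \<beta> / (1 + 2 * \<beta>)\<close>.\<close>
  have b_le: "b \<le> B" if "2 * \<beta> \<le> B * (1 + 2 * \<beta>)" for B
  proof -
    have "b \<le> 2 * \<beta> / (1 + 2 * \<beta>)"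
    proof -
      have "0 < (2 + \<beta>) * s - 3" using \<beta>s s by (simp add: algebra_simps)
      moreover have "\<beta> * 6 \<le> \<beta> * (3 * s)" using \<beta> s by (intro mult_left_mono) auto
      ultimately show ?thesis
        unfolding b_def using \<beta> by (simp add: divide_le_eq pos_le_divide_eq) (simp add: algebra_simps)
    qed
    also have "\<dots> \<le> B" using that \<beta> by (simp add: field_simps)
    finally show ?thesis .
  qed
  \<comment> \<open>\<open>c\<close> increases with \<beta>, because \<open>2 * s - 4 + m\<close> is
    nonnegative.\<close>
  have c_le: "c \<le> \<gamma> * s / (2 * s - 4 + m + \<gamma> * s)" if "\<beta> \<le> \<gamma>" for \<gamma>
  proof -
    have D1: "0 < 2 * s - 4 + m + \<beta> * s" using \<beta>s s m by linarith
    moreover have "\<beta> * s \<le> \<gamma> * s" using that s by (intro mult_right_mono) auto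
    ultimately have D2: "0 < 2 * s - 4 + m + \<gamma> * s" by linarith
    have "\<beta> * (2 * s - 4 + m) \<le> \<gamma> * (2 * s - 4 + m)" using that s m by (intro mult_right_mono) auto
    then have "s * (\<beta> * (2 * s - 4 + m)) \<le> s * (\<gamma> * (2 * s - 4 + m))"
      using s by (intro mult_left_mono) auto
    then have "\<beta> * s * (2 * s - 4 + m + \<gamma> * s) \<le> \<gamma> * s * (2 * s - 4 + m + \<beta> * s)"
      by (simp add: algebra_simps)
    then show ?thesis
      unfolding c_def
      by (intro mult_imp_div_pos_le[OF D1]) (simp only: times_divide_eq_left pos_le_divide_eq[OF D2])
  qed
  have c1: "c \<le> s / (3 * s - 4 + m)" using c_le[of 1] \<beta> by (simp add: algebra_simps)
  have c2: "c \<le> s / (2 * m + 5 * s - 8)" if "\<beta> \<le> 1 / 2"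
  proof -
    have "(1 / 2) * s / (2 * s - 4 + m + (1 / 2) * s) = s / (2 * m + 5 * s - 8)"
      using s m by (simp add: divide_simps)
    then show ?thesis using c_le[OF that] by (simp only:)
  qed
  have "m * b + (2 * s - 1) * c + 2 / \<beta> \<le> m + (2 * s - 1)"
  proof -
    \<comment> \<open>These are the four ranges of \<open>f_bound\<close>. In each, \<open>B\<close>
      is the bound on \<open>b\<close> at the upper end of the range, and \<open>C\<close> comes
      from \<open>c_le\<close> with \<gamma> equal to 1 in the first case and 1/2 in the others. In
      the first three cases \<open>q\<close> is \<open>2 / \<beta>\<close> at the lower end of the
      range.\<close>
    consider "1 / 2 \<le> \<beta>" | "1 / 3 \<le> \<beta>" "\<beta> < 1 / 2" | "1 / 4 \<le> \<beta>" "\<beta> < 1 / 3" | "\<beta> < 1 / 4"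
      by linarith
    then show ?thesis
    proof cases
      case 1
      then have n: "15 \<le> 3 * s + m" using n unfolding f_bound_def \<beta>_def by auto
      show ?thesis
      proof (rule join_weight_inequality_of_bounds[where B = "2 / 3" and C = "3 * s - 4 + m" and q = 4])
        show "b \<le> 2 / 3" using \<beta> by (intro b_le) simp
        show "2 / \<beta> \<le> 4" using 1 by (simp add: field_simps)
        have "3 * (s * (2 * s - 1)) \<le> (3 * s - 4 + m) * (m + 6 * s - 15)"
        \<comment> \<open>The split is where \<open>15 - 3 * s\<close>, the lower bound on
          \<open>m\<close> given by the order, changes sign: below it this bound is used, above it
          only \<open>0 \<le> m\<close>. The next two cases split at 6 and 7 for the same
          reason.\<close>
        proof (cases "s \<le> 5")
          case True
          have "11 * (3 * s) \<le> (3 * s - 4 + m) * (m + 6 * s - 15)"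
            using n s by (intro mult_mono) auto
          moreover have "s * s \<le> s * 5" using True s by (intro mult_left_mono) auto
          moreover have "3 * (s * (2 * s - 1)) = 6 * (s * s) - 3 * s" by (simp add: algebra_simps)
          ultimately show ?thesis using s by linarith
        next
          case False
          have "(3 * s - 4) * (6 * s - 15) \<le> (3 * s - 4 + m) * (m + 6 * s - 15)"
            using m False by (intro mult_mono) auto
          \<comment> \<open>The tangent of the square at the split point makes the remaining
            comparison linear.\<close>
          moreover have "10 * s - 25 \<le> s * s"
            using zero_le_square[of "s - 5"] by (simp add: algebra_simps)
          moreover have "(3 * s - 4) * (6 * s - 15) = 18 * (s * s) - 69 * s + 60" "3 * (s * (2 * s - 1)) = 6 * (s * s) - 3 * s"
            by (simp_all add: algebra_simps)
          ultimately show ?thesis using s False by linarith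
        qed
        then show "s * (2 * s - 1) \<le> (3 * s - 4 + m) * ((1 - 2 / 3) * m + (2 * s - 1) - 4)"
          by (simp add: algebra_simps)
      qed (use s m c1 in auto)
    next
      case 2
      then have n: "18 \<le> 3 * s + m" using n unfolding f_bound_def \<beta>_def by auto
      show ?thesis
      proof (rule join_weight_inequality_of_bounds[where B = "1 / 2" and C = "2 * m + 5 * s - 8" and q = 6])
        show "b \<le> 1 / 2" using 2 by (intro b_le) simp
        show "2 / \<beta> \<le> 6" using 2 by (simp add: field_simps)
        have "2 * (s * (2 * s - 1)) \<le> (2 * m + 5 * s - 8) * (m + 4 * s - 14)"
        proof (cases "s \<le> 6")
          case True
          have "s * s \<le> s * 6" using True s by (intro mult_left_mono) auto
          then have "4 * (s * s) - 2 * s \<le> 112 + 24 * s - s * s" using True by linarith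
          then have "2 * (s * (2 * s - 1)) \<le> (28 - s) * (4 + s)" by (simp add: algebra_simps)
          also have "\<dots> \<le> (2 * m + 5 * s - 8) * (m + 4 * s - 14)"
            using n s m True by (intro mult_mono) auto
          finally show ?thesis .
        next
          case False
          have "(5 * s - 8) * (4 * s - 14) \<le> (2 * m + 5 * s - 8) * (m + 4 * s - 14)"
            using m False by (intro mult_mono) auto
          moreover have "12 * s - 36 \<le> s * s"
            using zero_le_square[of "s - 6"] by (simp add: algebra_simps)
          moreover have "(5 * s - 8) * (4 * s - 14) = 20 * (s * s) - 102 * s + 112" "2 * (s * (2 * s - 1)) = 4 * (s * s) - 2 * s"
            by (simp_all add: algebra_simps)
          ultimately show ?thesis using s False by linarith
        qed
        then show "s * (2 * s - 1) \<le> (2 * m + 5 * s - 8) * ((1 - 1 / 2) * m + (2 * s - 1) - 6)"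
          by (simp add: algebra_simps)
      qed (use s m c2 2 in auto)
    next
      case 3
      then have n: "21 \<le> 3 * s + m" using n unfolding f_bound_def \<beta>_def by auto
      show ?thesis
      proof (rule join_weight_inequality_of_bounds[where B = "2 / 5" and C = "2 * m + 5 * s - 8" and q = 8])
        show "b \<le> 2 / 5" using 3 by (intro b_le) simp
        show "2 / \<beta> \<le> 8" using 3 by (simp add: field_simps)
        have "5 * (s * (2 * s - 1)) \<le> (2 * m + 5 * s - 8) * (3 * m + 10 * s - 45)"
        proof (cases "s \<le> 7")
          case True
          have "s * s \<le> s * 7" using True s by (intro mult_left_mono) auto
          then have "10 * (s * s) - 5 * s \<le> 612 + 16 * s - s * s" using True by linarith
          then have "5 * (s * (2 * s - 1)) \<le> (34 - s) * (18 + s)" by (simp add: algebra_simps)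
          also have "\<dots> \<le> (2 * m + 5 * s - 8) * (3 * m + 10 * s - 45)"
            using n s m True by (intro mult_mono) auto
          finally show ?thesis .
        next
          case False
          have "(5 * s - 8) * (10 * s - 45) \<le> (2 * m + 5 * s - 8) * (3 * m + 10 * s - 45)"
            using m False by (intro mult_mono) auto
          moreover have "14 * s - 49 \<le> s * s"
            using zero_le_square[of "s - 7"] by (simp add: algebra_simps)
          moreover have "(5 * s - 8) * (10 * s - 45) = 50 * (s * s) - 305 * s + 360" "5 * (s * (2 * s - 1)) = 10 * (s * s) - 5 * s"
            by (simp_all add: algebra_simps)
          ultimately show ?thesis using s False by linarith
        qed
        then show "s * (2 * s - 1) \<le> (2 * m + 5 * s - 8) * ((1 - 2 / 5) * m + (2 * s - 1) - 8)"
          by (simp add: algebra_simps)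
      qed (use s m c2 3 in auto)
    next
      case 4
      have "f_bound \<alpha> = 5 / \<beta> + 1" using 4 unfolding f_bound_def \<beta>_def by auto
      then have n: "5 / \<beta> \<le> 3 * s + m - 2" using n by simp
      moreover have "20 \<le> 5 / \<beta>" using 4 \<beta> by (simp add: field_simps)
      ultimately have n22: "22 \<le> 3 * s + m" by simp
      show ?thesis
      \<comment> \<open>Here \<beta> has no positive lower bound, so \<open>q\<close> comes from
        \<open>5 / \<beta> \<le> n - 1\<close> with \<open>n - 1 = 3 * s + m - 2\<close>, and it
        grows with the order.\<close>
      proof (rule join_weight_inequality_of_bounds[where B = "1 / 3" and C = "2 * m + 5 * s - 8"
            and q = "2 / 5 * (3 * s + m - 2)"])
        show "b \<le> 1 / 3" using 4 by (intro b_le) simp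
        show "2 / \<beta> \<le> 2 / 5 * (3 * s + m - 2)" using n by simp
        have "15 * (s * (2 * s - 1)) \<le> (2 * m + 5 * s - 8) * (4 * m + 12 * s - 3)"
        proof (cases "s \<le> 4")
          case True
          have "20 * 80 \<le> (2 * m + 5 * s - 8) * (4 * m + 12 * s - 3)"
            using n22 s m True by (intro mult_mono) auto
          moreover have "s * s \<le> s * 4" using True s by (intro mult_left_mono) auto
          moreover have "15 * (s * (2 * s - 1)) = 30 * (s * s) - 15 * s" by (simp add: algebra_simps)
          ultimately show ?thesis using s True by linarith
        next
          case False
          have "(5 * s - 8) * (12 * s - 3) \<le> (2 * m + 5 * s - 8) * (4 * m + 12 * s - 3)"
            using m False by (intro mult_mono) auto
          moreover have "s * 4 \<le> s * s" using False s by (intro mult_left_mono) auto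
          moreover have "(5 * s - 8) * (12 * s - 3) = 60 * (s * s) - 111 * s + 24" "15 * (s * (2 * s - 1)) = 30 * (s * s) - 15 * s"
            by (simp_all add: algebra_simps)
          ultimately show ?thesis using s False by linarith
        qed
        then have "s * (2 * s - 1) \<le> (2 * m + 5 * s - 8) * ((4 * m + 12 * s - 3) / 15)" by simp
        also have "(4 * m + 12 * s - 3) / 15 = (1 - 1 / 3) * m + (2 * s - 1) - 2 / 5 * (3 * s + m - 2)"
          by (simp add: field_simps)
        finally show "s * (2 * s - 1) \<le>
            (2 * m + 5 * s - 8) * ((1 - 1 / 3) * m + (2 * s - 1) - 2 / 5 * (3 * s + m - 2))" .
      qed (use s m c2 4 in auto)
    qed
  qed
  moreover have "(3 - \<alpha>) * s - 3 = (2 + \<beta>) * s - 3" "3 * s - 4 + m - \<alpha> * s = 2 * s - 4 + m + \<beta> * s"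
    unfolding \<alpha>\<beta> by (simp_all add: algebra_simps)
  ultimately show ?thesis unfolding b_def c_def \<beta>_def[symmetric] by (simp only:)
qed

section \<open>The bounds for one and for several vertices in \<open>S\<close>\<close>

lemma eigenvalue_le_eta_of_cut_vertex:
  assumes G: "simple_graph V E" and \<alpha>: "0 \<le> \<alpha>" "\<alpha> < 1" and n: "4 \<le> card V"
    and SJ: "S \<subseteq> V" "J \<subseteq> V - S" "card S = 1" "card J = 2"
    and nb: "\<And>u v. u \<in> J \<Longrightarrow> adj E u v \<Longrightarrow> v \<in> S"
    and ev: "is_eigenvalue V (A_alpha \<alpha> V E) mu"
  shows "mu \<le> eta \<alpha> (card V)"
proof -
  define n x where "n = real (card V)" and "x = eta \<alpha> n"
  have n4: "4 \<le> n" using n unfolding n_def by simp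
  have root: "eta_poly \<alpha> n x = 0" and gt: "n - 3 < x"
    using eta_root[OF \<alpha> n4] unfolding x_def by auto
  have p1: "0 < x - \<alpha>" and p2: "0 < x - n + 4 - \<alpha>" using gt n4 \<alpha> by linarith+
  have "mu \<le> x"
  \<comment> \<open>The weights are the eigenvector of the quotient matrix for \<open>x\<close>,
    cleared of denominators: the two inequalities for clique and leaves are equalities, and the one
    for the centre is the vanishing of the cubic. Positivity rests on
    \<open>n - 3 < x\<close>.\<close>
  proof (rule eigenvalue_le_of_join_weights[OF G _ _ SJ(1,2) nb, where s = 1 and t = 2 and m = "n - 3"
        and a = "(x - \<alpha>) * (x - n + 4 - \<alpha>)" and b = "(1 - \<alpha>) * (x - \<alpha>)" and c = "(1 - \<alpha>) * (x - n + 4 - \<alpha>)"])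
    show "(1 - 1) * ((x - \<alpha>) * (x - n + 4 - \<alpha>)) +
        (n - 3) * (\<alpha> * ((x - \<alpha>) * (x - n + 4 - \<alpha>)) + (1 - \<alpha>) * ((1 - \<alpha>) * (x - \<alpha>))) +
        2 * (\<alpha> * ((x - \<alpha>) * (x - n + 4 - \<alpha>)) + (1 - \<alpha>) * ((1 - \<alpha>) * (x - n + 4 - \<alpha>)))
      \<le> x * ((x - \<alpha>) * (x - n + 4 - \<alpha>))"
    proof -
      have "(1 - 1) * ((x - \<alpha>) * (x - n + 4 - \<alpha>)) +
        (n - 3) * (\<alpha> * ((x - \<alpha>) * (x - n + 4 - \<alpha>)) + (1 - \<alpha>) * ((1 - \<alpha>) * (x - \<alpha>))) +
        2 * (\<alpha> * ((x - \<alpha>) * (x - n + 4 - \<alpha>)) + (1 - \<alpha>) * ((1 - \<alpha>) * (x - n + 4 - \<alpha>)))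
        = x * ((x - \<alpha>) * (x - n + 4 - \<alpha>)) - eta_poly \<alpha> n x"
        unfolding eta_poly_quotient_form by (simp add: algebra_simps power2_eq_square)
      then show ?thesis using root by simp
    qed
    show "0 < (x - \<alpha>) * (x - n + 4 - \<alpha>)" "0 < (1 - \<alpha>) * (x - \<alpha>)" "0 < (1 - \<alpha>) * (x - n + 4 - \<alpha>)"
      using p1 p2 \<alpha> by simp_all
  qed (use SJ \<alpha> ev in \<open>auto simp: n_def algebra_simps\<close>)
  then show ?thesis unfolding x_def n_def .
qed

text \<open>The comparison graph is \<open>K_s \<or> (K_m \<union> (2s-1)K_1)\<close>. Normalising
  \<open>a = 1\<close> and \<open>L = n - 3\<close>, the weights \<open>b\<close> and
  \<open>c\<close> solve the clique and independent-set conditions exactly, so only the condition on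
  \<open>S\<close> remains.\<close>

lemma eigenvalue_le_card_minus_3:
  assumes G: "simple_graph V E" and \<alpha>: "0 \<le> \<alpha>" "\<alpha> < 1" and n: "f_bound \<alpha> \<le> card V"
    and SJ: "S \<subseteq> V" "J \<subseteq> V - S" "2 \<le> card S" "card J + 1 = 2 * card S"
    and nb: "\<And>u v. u \<in> J \<Longrightarrow> adj E u v \<Longrightarrow> v \<in> S"
    and ev: "is_eigenvalue V (A_alpha \<alpha> V E) mu"
  shows "mu \<le> real (card V) - 3"
proof -
  define s where "s = real (card S)"
  define m where "m = real (card V) - 3 * s + 1"
  define b where "b = (1 - \<alpha>) * s / ((3 - \<alpha>) * s - 3)"
  define c where "c = (1 - \<alpha>) * s / (3 * s - 4 + m - \<alpha> * s)"
  have fin: "finite V" using G unfolding simple_graph_def by simp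
  have t: "real (card J) = 2 * s - 1" using SJ(4) unfolding s_def by simp
  have s: "2 \<le> s" using SJ(3) unfolding s_def by simp
  have "card (S \<union> J) \<le> card V" using SJ fin by (intro card_mono) auto
  moreover have "card (S \<union> J) = card S + card J"
    using SJ(1,2) fin by (intro card_Un_disjoint) (auto intro: finite_subset)
  ultimately have m: "0 \<le> m" using t unfolding m_def s_def by simp
  have "\<alpha> * s < 1 * s" using \<alpha> s by (intro mult_strict_right_mono) auto
  then have d1: "0 < (3 - \<alpha>) * s - 3" and d2: "0 < 3 * s - 4 + m - \<alpha> * s"
    using s m unfolding left_diff_distrib by linarith+
  have key: "m * b + (2 * s - 1) * c + 2 / (1 - \<alpha>) \<le> m + (2 * s - 1)"
    unfolding b_def c_def using \<alpha> s m n by (intro join_weight_inequality) (simp_all add: m_def)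
  have b: "b * ((3 - \<alpha>) * s - 3) = (1 - \<alpha>) * s" unfolding b_def using d1 by simp
  have c: "c * (3 * s - 4 + m - \<alpha> * s) = (1 - \<alpha>) * s" unfolding c_def using d2 by simp
  have L: "real (card V) - 3 = 3 * s - 4 + m" unfolding m_def by simp
  show ?thesis
    unfolding L
  proof (rule eigenvalue_le_of_join_weights[OF G _ _ SJ(1,2) nb, where s = s and t = "2 * s - 1" and m = m
        and a = 1 and b = b and c = c])
    show "0 < b" "0 < c" unfolding b_def c_def using d1 d2 \<alpha> s by simp_all
    show "s * (\<alpha> * c + (1 - \<alpha>) * 1) \<le> (3 * s - 4 + m) * c" using c by (simp add: algebra_simps)
    show "s * (\<alpha> * b + (1 - \<alpha>) * 1) + (m - 1) * b \<le> (3 * s - 4 + m) * b" using b by (simp add: algebra_simps)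
    \<comment> \<open>Moving \<open>s - 1\<close> and the \<alpha> terms of the condition on
      \<open>S\<close> to the right leaves \<open>(1 - \<alpha>) * (m + (2 * s - 1)) - 2\<close>;
      dividing by \<open>1 - \<alpha>\<close> explains the summand \<open>2 / (1 - \<alpha>)\<close>
      in \<open>key\<close>.\<close>
    have "(1 - \<alpha>) * (m * b + (2 * s - 1) * c + 2 / (1 - \<alpha>)) \<le> (1 - \<alpha>) * (m + (2 * s - 1))"
      using key \<alpha> by (intro mult_left_mono) auto
    moreover have "(1 - \<alpha>) * (2 / (1 - \<alpha>)) = 2" using \<alpha> by (simp add: field_simps)
    ultimately have "(1 - \<alpha>) * (m * b + (2 * s - 1) * c) + 2 \<le> (1 - \<alpha>) * (m + (2 * s - 1))"
      by (simp only: distrib_left)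
    then show "(s - 1) * 1 + m * (\<alpha> * 1 + (1 - \<alpha>) * b) + (2 * s - 1) * (\<alpha> * 1 + (1 - \<alpha>) * c)
        \<le> (3 * s - 4 + m) * 1"
      by (simp add: algebra_simps)
  qed (use \<alpha> t ev in \<open>auto simp: s_def m_def\<close>)
qed

lemma f_bound_ge: "\<alpha> < 1 \<Longrightarrow> 14 \<le> f_bound \<alpha>"
  unfolding f_bound_def by (auto simp: field_simps)

theorem theorem1p2:
  fixes \<alpha> :: real and V :: "'a set" and E :: "'a set set"
  assumes "0 \<le> \<alpha>" and "\<alpha> < 1"
    and "simple_graph V E" and "connected_graph V E"
    and "real (card V) \<ge> f_bound \<alpha>"
    and "rho_alpha \<alpha> V E > eta \<alpha> (real (card V))"
  shows "P_ge_factor_covered 2 V E"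
proof (rule ccontr)
  assume nc: "\<not> P_ge_factor_covered 2 V E"
  note G = assms(3)
  have n: "14 \<le> card V" using f_bound_ge[OF assms(2)] assms(5) by linarith
  have "V \<noteq> {}" using n by auto
  \<comment> \<open>The first step of a walk to any other vertex supplies a neighbour.\<close>
  have nbr: "\<exists>u. adj E v u" if v: "v \<in> V" for v
  proof -
    have "V \<noteq> {v}" using n by auto
    then obtain w where "w \<in> V" "v \<noteq> w" using v by blast
    then have "(v, w) \<in> {(x, y). adj E x y}\<^sup>*" using assms(4) v unfolding connected_graph_def by blast
    then show ?thesis using \<open>v \<noteq> w\<close> by (auto elim: converse_rtranclE)
  qed
  obtain S J where SJ: "S \<subseteq> V" "S \<noteq> {}" "J \<subseteq> V - S" "\<And>u v. u \<in> J \<Longrightarrow> adj E u v \<Longrightarrow> v \<in> S"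
    "2 \<le> card J" "2 * card S \<le> card J + 1"
    using not_covered_imp_large_independent_set[OF G nbr nc] by metis
  have finS: "finite S" using SJ(1) G finite_subset unfolding simple_graph_def by blast
  have "0 < card S" using finS SJ(2) by (simp add: card_gt_0_iff)
  have ev: "is_eigenvalue V (A_alpha \<alpha> V E) (rho_alpha \<alpha> V E)"
    using rho_alpha_is_eigenvalue[OF G \<open>V \<noteq> {}\<close>] .
  have "rho_alpha \<alpha> V E \<le> eta \<alpha> (real (card V))"
  proof (cases "card S = 1")
    case True
    \<comment> \<open>\<open>J\<close> may be too large for the comparison graph. Its surplus
      vertices are counted in the clique, which only adds edges to the comparison graph; the other
      case trims \<open>J\<close> in the same way.\<close>
    obtain K where K: "K \<subseteq> J" "card K = 2" using obtain_subset_with_card_n[OF SJ(5)] by blast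
    have "K \<subseteq> V - S" using K(1) SJ(3) by blast
    moreover have "v \<in> S" if "u \<in> K" "adj E u v" for u v using that K(1) SJ(4) by blast
    moreover have "4 \<le> card V" using n by simp
    ultimately show ?thesis
      using eigenvalue_le_eta_of_cut_vertex[OF G assms(1,2) _ SJ(1) _ True K(2) _ ev] by blast
  next
    case False
    have "2 * card S - 1 \<le> card J" using SJ(6) by simp
    then obtain K where K: "K \<subseteq> J" "card K = 2 * card S - 1"
      using obtain_subset_with_card_n by blast
    have "K \<subseteq> V - S" using K(1) SJ(3) by blast
    moreover have "v \<in> S" if "u \<in> K" "adj E u v" for u v using that K(1) SJ(4) by blast
    moreover have "2 \<le> card S" "card K + 1 = 2 * card S"
      using False \<open>0 < card S\<close> K(2) by auto
    ultimately have "rho_alpha \<alpha> V E \<le> real (card V) - 3"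
      using eigenvalue_le_card_minus_3[OF G assms(1,2,5) SJ(1) _ _ _ _ ev] by blast
    also have "\<dots> \<le> eta \<alpha> (real (card V))"
      using eta_root(2)[OF assms(1,2), of "real (card V)"] n by simp
    finally show ?thesis .
  qed
  then show False using assms(6) by simp
qed

end
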